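(* Let $M$ be a complete $n$-dimensional Riemannian manifold with Riemannian distance $d$, and let $f:M\to\mathbb{R}$ be a $C^1$ function with $L$-Lipschitz gradient ($L>0$) which is bounded from below. Let $D:M\times M\to\mathbb{R}$ be a quasi distance and assume that there exist $s_1,s_2>0$ such that $$s_1 d(x,y)\le D(x,y)\le s_2 d(x,y),\qquad x,y\in M.$$ Let $r_1,r_2>0$. If $f$ is a KL function, then each bounded sequence $\{x^k\}_{k\ge0}\subset M$ satisfying, for all $k=0,1,\ldots$, $$f(x^{k+1})+r_1D^2(x^{k+1},x^k)\le f(x^k)\qquad\text{and}\qquad \|\mathrm{grad} f(x^k)\|\le r_2 D(x^{k+1},x^k),$$ converges to some critical point $\bar x$ of $f$.
   Context: Boundedness of the sequence is with respect to the Riemannian distance. Quasi distance: a map $D:M\times M\to\mathbb{R}_+$ such that (i) for all $x,y\in M$, $D(x,y)=D(y,x)=0\Leftrightarrow x=y$; (ii) $D(x,z)\le D(x,y)+D(y,z)$ for all $x,y,z\in M$. (Symmetry is not required.) $L$-Lipschitz gradient: a $C^1$ function $f:M\to\mathbb{R}$ has $L$-Lipschitz gradient if for any $x,y\in M$ and any geodesic segment $\gamma:[0,r]\to M$ joining $x=\gamma(0)$ and $y=\gamma(r)$, one has $\|\mathrm{grad} f(\gamma(t))-P_{\gamma(0)\gamma(t)}\mathrm{grad} f(x)\|\le L\,l(t)$ for all $t\in[0,r]$, where $l(t)$ is the length of $\gamma$ between $\gamma(0)$ and $\gamma(t)$ and $P_{\gamma(0)\gamma(t)}$ is parallel transport along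 $\gamma$. Subdifferentials: for a lower semicontinuous $f:M\to\mathbb{R}\cup\{+\infty\}$ and $x$ with $f(x)<+\infty$, the Fréchet subdifferential is $\hat\partial f(x)=\{dh_x: h\in C^1(M),\ f-h \text{ attains a local minimum at } x\}$, where $dh_x$ is identified with $\mathrm{grad}\,h(x)\in T_xM$; the (limiting) subdifferential is $\partial f(x)=\{v\in T_xM:\exists (x^n,v^n)\in TM,\ v^n\in\hat\partial f(x^n),\ (x^n,v^n)\to(x,v),\ f(x^n)\to f(x)\}$. For $f$ of class $C^1$, $\partial f(x)=\{\mathrm{grad} f(x)\}$. A point $x$ is critical if $0\in\partial f(x)$. $dist(0,\partial f(x))=\inf\{\|v\|:v\in\partial f(x)\}$. Kurdyka-Lojasiewicz property at $\bar x\in\mathrm{dom}\,\partial f=\{x:\partial f(x)\ne\emptyset\}$: there exist $\eta\in(0,+\infty]$, a neighborhood $U$ of $\bar x$ and a continuous concave function $\varphi:[0,\eta)\to\mathbb{R}_+$ such that (i) $\varphi(0)=0$, $\varphi\in C^1(0,\eta)$ and $\varphi'(s)>0$ for all $s\in(0,\eta)$; (ii) for all $x\in U$ with $f(\bar x)<f(x)<f(\bar x)+\eta$, $\varphi'(f(x)-f(\bar x))\,dist(0,\partial f(x))\ge 1$. $f$ is a KL function if it has this property at each point of $\mathrm{dom}\,\partial f$. *)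

theory Defs
  imports "HOL-Analysis.Analysis"
begin

section \<open>Smooth manifolds\<close>

text \<open>
  The manifold is the whole type \<^typ>\<open>'a\<close> with its class topology, modelled on
  \<^typ>\<open>real^'n\<close>, so its dimension is \<^term>\<open>CARD('n)\<close>. A chart is a pair of its domain and its
  coordinate map; values of the coordinate map outside the domain are irrelevant.
  The smooth structure is given by an atlas, not required to be maximal.
\<close>

type_synonym ('a, 'n) chart = "'a set \<times> ('a \<Rightarrow> real^'n)"

abbreviation chart_dom :: "('a, 'n) chart \<Rightarrow> 'a set" where
  "chart_dom c \<equiv> fst c"

abbreviation chart_map :: "('a, 'n) chart \<Rightarrow> 'a \<Rightarrow> real^'n" where
  "chart_map c \<equiv> snd c"

definition chart_img :: "('a, 'n) chart \<Rightarrow> (real^'n) set" where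
  "chart_img c = chart_map c ` chart_dom c"

definition chart_inv :: "('a, 'n) chart \<Rightarrow> real^'n \<Rightarrow> 'a" where
  "chart_inv c = inv_into (chart_dom c) (chart_map c)"

text \<open>Class \<open>C\<^sup>k\<close>, intended for open \<open>S\<close>.\<close>

primrec Ck_on :: "nat \<Rightarrow> 'a::real_normed_vector set \<Rightarrow> ('a \<Rightarrow> 'b::real_normed_vector) \<Rightarrow> bool" where
  "Ck_on 0 S f \<longleftrightarrow> continuous_on S f"
| "Ck_on (Suc k) S f \<longleftrightarrow> (\<forall>x\<in>S. f differentiable (at x)) \<and>
     (\<forall>v. Ck_on k S (\<lambda>x. frechet_derivative f (at x) v))"

definition smooth_on :: "'a::real_normed_vector set \<Rightarrow> ('a \<Rightarrow> 'b::real_normed_vector) \<Rightarrow> bool" where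
  "smooth_on S f \<longleftrightarrow> (\<forall>k. Ck_on k S f)"

definition smooth_atlas :: "('a::topological_space, 'n::finite) chart set \<Rightarrow> bool" where
  "smooth_atlas A \<longleftrightarrow>
     (\<forall>c\<in>A. open (chart_dom c) \<and> open (chart_img c) \<and>
        homeomorphism (chart_dom c) (chart_img c) (chart_map c) (chart_inv c)) \<and>
     (\<Union>c\<in>A. chart_dom c) = UNIV \<and>
     (\<forall>c\<in>A. \<forall>c'\<in>A. smooth_on (chart_map c ` (chart_dom c \<inter> chart_dom c')) (chart_map c' \<circ> chart_inv c))"

definition C1_fun :: "('a, 'n::finite) chart set \<Rightarrow> ('a \<Rightarrow> real) \<Rightarrow> bool" where
  "C1_fun A h \<longleftrightarrow> (\<forall>c\<in>A. Ck_on 1 (chart_img c) (h \<circ> chart_inv c))"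


section \<open>Tangent vectors\<close>

text \<open>
  A tangent vector at \<open>p\<close> is the family of its coordinate vectors in all charts around \<open>p\<close>,
  related by the derivatives of the transition maps. Components at all other index pairs
  are fixed to zero, so that equality of tangent vectors is equality of functions.
\<close>

type_synonym ('a, 'n) tvec = "('a, 'n) chart \<Rightarrow> real^'n"

definition transition_deriv ::
    "('a, 'n::finite) chart \<Rightarrow> ('a, 'n) chart \<Rightarrow> 'a \<Rightarrow> real^'n \<Rightarrow> real^'n" where
  "transition_deriv c c' p = frechet_derivative (chart_map c' \<circ> chart_inv c) (at (chart_map c p))"

definition tangent_space :: "('a, 'n::finite) chart set \<Rightarrow> 'a \<Rightarrow> ('a, 'n) tvec set" where
  "tangent_space A p = {v.
     (\<forall>c\<in>A. \<forall>c'\<in>A. p \<in> chart_dom c \<inter> chart_dom c' \<longrightarrow> v c' = transition_deriv c c' p (v c)) \<and>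
     (\<forall>c. \<not> (c \<in> A \<and> p \<in> chart_dom c) \<longrightarrow> v c = 0)}"

text \<open>The tangent vector at \<open>p\<close> with coordinates \<open>w\<close> in the chart \<open>c\<close>.\<close>

definition tvec_of :: "('a, 'n::finite) chart set \<Rightarrow> ('a, 'n) chart \<Rightarrow> 'a \<Rightarrow> real^'n \<Rightarrow> ('a, 'n) tvec" where
  "tvec_of A c p w =
     (\<lambda>c'. if c' \<in> A \<and> p \<in> chart_dom c' then transition_deriv c c' p w else 0)"

text \<open>Convergence in the tangent bundle of \<open>(x\<^sub>n, v\<^sub>n)\<close> to \<open>(x, v)\<close>.\<close>

definition TM_tendsto :: "('a::topological_space, 'n::finite) chart set \<Rightarrow>
    (nat \<Rightarrow> 'a) \<Rightarrow> (nat \<Rightarrow> ('a, 'n) tvec) \<Rightarrow> 'a \<Rightarrow> ('a, 'n) tvec \<Rightarrow> bool" where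
  "TM_tendsto A xs vs x v \<longleftrightarrow>
     (\<forall>n. vs n \<in> tangent_space A (xs n)) \<and> v \<in> tangent_space A x \<and>
     xs \<longlonglongrightarrow> x \<and> (\<forall>c\<in>A. x \<in> chart_dom c \<longrightarrow> (\<lambda>n. vs n c) \<longlonglongrightarrow> v c)"


section \<open>Riemannian metrics\<close>

type_synonym ('a, 'n) metric_tensor = "'a \<Rightarrow> ('a, 'n) tvec \<Rightarrow> ('a, 'n) tvec \<Rightarrow> real"

text \<open>The matrix \<open>(g\<^sub>i\<^sub>j)\<close> in the coordinates of \<open>c\<close>.\<close>

definition metric_matrix :: "('a, 'n::finite) chart set \<Rightarrow> ('a, 'n) metric_tensor \<Rightarrow>
    ('a, 'n) chart \<Rightarrow> real^'n \<Rightarrow> real^'n^'n" where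
  "metric_matrix A g c x = (\<chi> i j. let p = chart_inv c x in
     g p (tvec_of A c p (axis i 1)) (tvec_of A c p (axis j 1)))"

definition riemannian_metric :: "('a, 'n::finite) chart set \<Rightarrow> ('a, 'n) metric_tensor \<Rightarrow> bool" where
  "riemannian_metric A g \<longleftrightarrow>
     (\<forall>p. \<forall>u\<in>tangent_space A p. \<forall>v\<in>tangent_space A p. \<forall>w\<in>tangent_space A p. \<forall>a b.
        g p u v = g p v u \<and>
        g p (\<lambda>c. a *\<^sub>R u c + b *\<^sub>R v c) w = a * g p u w + b * g p v w \<and>
        (u \<noteq> (\<lambda>_. 0) \<longrightarrow> g p u u > 0)) \<and>
     (\<forall>c\<in>A. \<forall>i j. smooth_on (chart_img c) (\<lambda>x. metric_matrix A g c x $ i $ j))"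

text \<open>Manifolds are Hausdorff, second countable and connected (the Riemannian distance
  is finite only in the connected case).\<close>

definition riemannian_manifold ::
    "('a::{t2_space, second_countable_topology}, 'n::finite) chart set \<Rightarrow> ('a, 'n) metric_tensor \<Rightarrow> bool" where
  "riemannian_manifold A g \<longleftrightarrow>
     connected (UNIV :: 'a set) \<and> smooth_atlas A \<and> riemannian_metric A g"

definition tnorm :: "('a, 'n) metric_tensor \<Rightarrow> 'a \<Rightarrow> ('a, 'n) tvec \<Rightarrow> real" where
  "tnorm g p v = sqrt (g p v v)"

text \<open>\<open>grad h p\<close> is the tangent vector with \<open>\<langle>grad h p, v\<rangle> = dh\<^sub>p v\<close> for all \<open>v\<close>.\<close>

definition grad :: "('a, 'n::finite) chart set \<Rightarrow> ('a, 'n) metric_tensor \<Rightarrow>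
    ('a \<Rightarrow> real) \<Rightarrow> 'a \<Rightarrow> ('a, 'n) tvec" where
  "grad A g h p = (THE w. w \<in> tangent_space A p \<and>
     (\<forall>v\<in>tangent_space A p. \<forall>c\<in>A. p \<in> chart_dom c \<longrightarrow>
        g p w v = frechet_derivative (h \<circ> chart_inv c) (at (chart_map c p)) (v c)))"


section \<open>Curves and the Riemannian distance\<close>

text \<open>The velocity at \<open>t\<close> of a curve with parameter interval \<open>I\<close>; derivatives at the end points
  of \<open>I\<close> are one-sided.\<close>

definition velocity :: "('a, 'n::finite) chart set \<Rightarrow> real set \<Rightarrow> (real \<Rightarrow> 'a) \<Rightarrow> real \<Rightarrow> ('a, 'n) tvec" where
  "velocity A I \<gamma> t = (\<lambda>c. if c \<in> A \<and> \<gamma> t \<in> chart_dom c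
     then vector_derivative (chart_map c \<circ> \<gamma>) (at t within I) else 0)"

definition C1_curve :: "('a::topological_space, 'n::finite) chart set \<Rightarrow> real set \<Rightarrow> (real \<Rightarrow> 'a) \<Rightarrow> bool" where
  "C1_curve A I \<gamma> \<longleftrightarrow> continuous_on I \<gamma> \<and>
     (\<forall>c\<in>A. let J = {t\<in>I. \<gamma> t \<in> chart_dom c} in
        (\<forall>t\<in>J. (chart_map c \<circ> \<gamma>) differentiable (at t within I)) \<and>
        continuous_on J (\<lambda>t. vector_derivative (chart_map c \<circ> \<gamma>) (at t within I)))"

definition piecewise_C1_curve :: "('a::topological_space, 'n::finite) chart set \<Rightarrow>
    real \<Rightarrow> real \<Rightarrow> (real \<Rightarrow> 'a) \<Rightarrow> bool" where
  "piecewise_C1_curve A a b \<gamma> \<longleftrightarrow>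
     (\<exists>(m::nat) \<tau>. \<tau> 0 = a \<and> \<tau> m = b \<and>
        (\<forall>i<m. \<tau> i < \<tau> (Suc i) \<and> C1_curve A {\<tau> i..\<tau> (Suc i)} \<gamma>))"

text \<open>At the finitely many break points of a piecewise \<open>C\<^sup>1\<close> curve the value of
  \<^const>\<open>velocity\<close> is meaningless, but does not affect the integral.\<close>

definition curve_length :: "('a, 'n::finite) chart set \<Rightarrow> ('a, 'n) metric_tensor \<Rightarrow>
    real \<Rightarrow> real \<Rightarrow> (real \<Rightarrow> 'a) \<Rightarrow> real" where
  "curve_length A g a b \<gamma> = integral {a..b} (\<lambda>t. tnorm g (\<gamma> t) (velocity A {a..b} \<gamma> t))"

definition rdist :: "('a::topological_space, 'n::finite) chart set \<Rightarrow> ('a, 'n) metric_tensor \<Rightarrow>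
    'a \<Rightarrow> 'a \<Rightarrow> real" where
  "rdist A g x y =
     Inf {curve_length A g a b \<gamma> | a b \<gamma>. piecewise_C1_curve A a b \<gamma> \<and> \<gamma> a = x \<and> \<gamma> b = y}"


section \<open>Parallel transport and geodesics\<close>

text \<open>\<open>\<Gamma>\<^sup>k\<^sub>i\<^sub>j = 1/2 \<Sum>\<^sub>l g\<^sup>k\<^sup>l (\<partial>\<^sub>i g\<^sub>j\<^sub>l + \<partial>\<^sub>j g\<^sub>i\<^sub>l - \<partial>\<^sub>l g\<^sub>i\<^sub>j)\<close> of the Levi-Civita connection.\<close>

definition christoffel :: "('a, 'n::finite) chart set \<Rightarrow> ('a, 'n) metric_tensor \<Rightarrow>
    ('a, 'n) chart \<Rightarrow> real^'n \<Rightarrow> 'n \<Rightarrow> 'n \<Rightarrow> 'n \<Rightarrow> real" where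
  "christoffel A g c x k i j =
     (let dg = (\<lambda>i j l. frechet_derivative (\<lambda>y. metric_matrix A g c y $ j $ l) (at x) (axis i 1))
      in 1/2 * (\<Sum>l\<in>UNIV. matrix_inv (metric_matrix A g c x) $ k $ l * (dg i j l + dg j i l - dg l i j)))"

text \<open>\<open>V\<close> is a field along \<open>\<gamma>\<close> with vanishing covariant derivative, i.e. in coordinates
  \<open>(V\<^sup>k)' + \<Sum>\<^sub>i\<^sub>j \<Gamma>\<^sup>k\<^sub>i\<^sub>j (\<gamma>\<^sup>i)' V\<^sup>j = 0\<close>.\<close>

definition parallel_along :: "('a, 'n::finite) chart set \<Rightarrow> ('a, 'n) metric_tensor \<Rightarrow>
    real set \<Rightarrow> (real \<Rightarrow> 'a) \<Rightarrow> (real \<Rightarrow> ('a, 'n) tvec) \<Rightarrow> bool" where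
  "parallel_along A g I \<gamma> V \<longleftrightarrow>
     (\<forall>t\<in>I. V t \<in> tangent_space A (\<gamma> t) \<and>
        (\<forall>c\<in>A. \<gamma> t \<in> chart_dom c \<longrightarrow>
           ((\<lambda>s. V s c) has_vector_derivative
             - (\<chi> k. \<Sum>i\<in>UNIV. \<Sum>j\<in>UNIV.
                  christoffel A g c (chart_map c (\<gamma> t)) k i j * velocity A I \<gamma> t c $ i * V t c $ j))
           (at t within I)))"

definition geodesic :: "('a::topological_space, 'n::finite) chart set \<Rightarrow> ('a, 'n) metric_tensor \<Rightarrow>
    real set \<Rightarrow> (real \<Rightarrow> 'a) \<Rightarrow> bool" where
  "geodesic A g I \<gamma> \<longleftrightarrow> C1_curve A I \<gamma> \<and> parallel_along A g I \<gamma> (velocity A I \<gamma>)"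

text \<open>Parallel transport of \<open>v\<close> from \<open>\<gamma> a\<close> to \<open>\<gamma> t\<close>.\<close>

definition parallel_transport :: "('a, 'n::finite) chart set \<Rightarrow> ('a, 'n) metric_tensor \<Rightarrow>
    real set \<Rightarrow> (real \<Rightarrow> 'a) \<Rightarrow> real \<Rightarrow> real \<Rightarrow> ('a, 'n) tvec \<Rightarrow> ('a, 'n) tvec" where
  "parallel_transport A g I \<gamma> a t v = (THE w. \<exists>V. parallel_along A g I \<gamma> V \<and> V a = v \<and> V t = w)"

definition lipschitz_gradient :: "('a::topological_space, 'n::finite) chart set \<Rightarrow> ('a, 'n) metric_tensor \<Rightarrow>
    real \<Rightarrow> ('a \<Rightarrow> real) \<Rightarrow> bool" where
  "lipschitz_gradient A g L f \<longleftrightarrow>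
     (\<forall>x y r \<gamma>. r > 0 \<and> geodesic A g {0..r} \<gamma> \<and> \<gamma> 0 = x \<and> \<gamma> r = y \<longrightarrow>
        (\<forall>t\<in>{0..r}.
           tnorm g (\<gamma> t)
             (\<lambda>c. grad A g f (\<gamma> t) c - parallel_transport A g {0..r} \<gamma> 0 t (grad A g f x) c)
           \<le> L * curve_length A g 0 t \<gamma>))"


section \<open>Subdifferentials and the Kurdyka-Lojasiewicz property\<close>

definition frechet_subdiff :: "('a::topological_space, 'n::finite) chart set \<Rightarrow> ('a, 'n) metric_tensor \<Rightarrow>
    ('a \<Rightarrow> ereal) \<Rightarrow> 'a \<Rightarrow> ('a, 'n) tvec set" where
  "frechet_subdiff A g f x = {grad A g h x | h. f x < \<infinity> \<and> C1_fun A h \<and>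
     (\<exists>U. open U \<and> x \<in> U \<and> (\<forall>y\<in>U. f x - ereal (h x) \<le> f y - ereal (h y)))}"

definition limiting_subdiff :: "('a::topological_space, 'n::finite) chart set \<Rightarrow> ('a, 'n) metric_tensor \<Rightarrow>
    ('a \<Rightarrow> ereal) \<Rightarrow> 'a \<Rightarrow> ('a, 'n) tvec set" where
  "limiting_subdiff A g f x = {v \<in> tangent_space A x. f x < \<infinity> \<and>
     (\<exists>xs vs. (\<forall>n. vs n \<in> frechet_subdiff A g f (xs n)) \<and>
        TM_tendsto A xs vs x v \<and> (\<lambda>n. f (xs n)) \<longlonglongrightarrow> f x)}"

definition critical_point :: "('a::topological_space, 'n::finite) chart set \<Rightarrow> ('a, 'n) metric_tensor \<Rightarrow>
    ('a \<Rightarrow> ereal) \<Rightarrow> 'a \<Rightarrow> bool" where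
  "critical_point A g f x \<longleftrightarrow> (\<lambda>_. 0) \<in> limiting_subdiff A g f x"

text \<open>The distance of \<open>0\<close> from an empty subdifferential is \<open>\<infinity>\<close>.\<close>

definition dist0_subdiff :: "('a::topological_space, 'n::finite) chart set \<Rightarrow> ('a, 'n) metric_tensor \<Rightarrow>
    ('a \<Rightarrow> ereal) \<Rightarrow> 'a \<Rightarrow> ereal" where
  "dist0_subdiff A g f x = (INF v\<in>limiting_subdiff A g f x. ereal (tnorm g x v))"

definition KL_property :: "('a::topological_space, 'n::finite) chart set \<Rightarrow> ('a, 'n) metric_tensor \<Rightarrow>
    ('a \<Rightarrow> ereal) \<Rightarrow> 'a \<Rightarrow> bool" where
  "KL_property A g f xb \<longleftrightarrow>
     (\<exists>(\<eta>::ereal) U (\<phi>::real \<Rightarrow> real). 0 < \<eta> \<and> xb \<in> interior U \<and>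
        continuous_on {s. 0 \<le> s \<and> ereal s < \<eta>} \<phi> \<and>
        concave_on {s. 0 \<le> s \<and> ereal s < \<eta>} \<phi> \<and>
        (\<forall>s. 0 \<le> s \<and> ereal s < \<eta> \<longrightarrow> 0 \<le> \<phi> s) \<and>
        \<phi> 0 = 0 \<and>
        (\<forall>s. 0 < s \<and> ereal s < \<eta> \<longrightarrow> \<phi> differentiable (at s) \<and> 0 < deriv \<phi> s) \<and>
        continuous_on {s. 0 < s \<and> ereal s < \<eta>} (deriv \<phi>) \<and>
        (\<forall>x\<in>U. f xb < f x \<and> f x < f xb + \<eta> \<longrightarrow>
           ereal (deriv \<phi> (real_of_ereal (f x - f xb))) * dist0_subdiff A g f x \<ge> 1))"

definition KL_function :: "('a::topological_space, 'n::finite) chart set \<Rightarrow> ('a, 'n) metric_tensor \<Rightarrow>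
    ('a \<Rightarrow> ereal) \<Rightarrow> bool" where
  "KL_function A g f \<longleftrightarrow> (\<forall>xb. limiting_subdiff A g f xb \<noteq> {} \<longrightarrow> KL_property A g f xb)"


section \<open>Quasi distances\<close>

definition quasi_distance :: "('a \<Rightarrow> 'a \<Rightarrow> real) \<Rightarrow> bool" where
  "quasi_distance D \<longleftrightarrow>
     (\<forall>x y. 0 \<le> D x y) \<and>
     (\<forall>x y. (D x y = 0 \<and> D y x = 0) \<longleftrightarrow> x = y) \<and>
     (\<forall>x y z. D x z \<le> D x y + D y z)"

end

theory Submission
  imports Defs
begin

text \<open>
  The squared steps \<open>D(x\<^sub>k\<^sub>+\<^sub>1, x\<^sub>k)\<^sup>2\<close> are dominated by the decrease of \<open>f\<close>, and the slopes by the steps.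
  As \<open>f\<close> is bounded below, the steps and the gradients tend to zero, so every limit of the
  sequence is critical, coordinates of tangent vectors being locally controlled by their norms
  (\<open>critical_point_of_grad_tendsto_0\<close>). What remains is convergence to a single point.

  Bounded closed sets of a complete Riemannian manifold are compact, so there is a cluster point \<open>b\<close>,
  and \<open>f (x\<^sub>k)\<close> decreases to \<open>f b\<close>. The Kurdyka-Lojasiewicz inequality at \<open>b\<close>, the concavity of \<open>\<phi>\<close>
  and the two conditions on the sequence combine to
  \<open>(r\<^sub>1 / r\<^sub>2) D(x\<^sub>k\<^sub>+\<^sub>1, x\<^sub>k) \<le> \<phi>(f(x\<^sub>k) - f b) - \<phi>(f(x\<^sub>k\<^sub>+\<^sub>1) - f b)\<close> as long as \<open>x\<^sub>k\<close> is near \<open>b\<close>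
  (\<open>KL_step_bound\<close>). The sum of the steps telescopes, so a sequence that comes close to \<open>b\<close> with a small
  gap \<open>f(x\<^sub>k) - f b\<close> stays close to \<open>b\<close> (\<open>descent_trapped_converges\<close>). This part lives in a metric space.

  The Riemannian part supplies that metric space. Norms of tangent vectors are locally equivalent to the
  Euclidean norms of their coordinates. Hence coordinate segments bound the distance from above, while
  every curve pays for its coordinate displacement until it leaves a coordinate ball (\<open>reach_segment\<close>,
  \<open>reach_short_stays\<close>); so the Riemannian distance is a metric that induces the topology of the manifold.
  Since curves can be cut at any length, completeness and local compactness imply compactness of bounded
  closed sets without recourse to geodesics (\<open>length_space_mcball_compactin\<close>). A \<open>C\<^sup>1\<close> function is
  a test function for itself, so its gradient belongs to its limiting subdifferential; that turns the
  Kurdyka-Lojasiewicz inequality into one for gradients (\<open>dist0_subdiff_le_tnorm_grad\<close>).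
\<close>

section \<open>Complete locally compact length spaces are proper\<close>

text \<open>
  This is the metric form of the Hopf--Rinow theorem (Cohn-Vossen). The hypothesis \<open>split\<close> replaces
  the existence of minimizing curves: it says that an upper bound of a distance can be divided
  arbitrarily between two steps, which holds whenever distances are infima of lengths of curves.
  If not all closed balls around \<open>p\<close> are compact, let \<open>R\<close> be the supremum of the radii of compact ones. The
  closed ball of radius \<open>R\<close> is still compact, as it is totally bounded: its points are close to those of a
  slightly smaller ball, which has finite nets. By local compactness a slightly larger ball is then
  compact, too, contradicting the choice of \<open>R\<close>.
\<close>

lemma (in Metric_space) length_space_mcball_compactin:
  assumes complete: "mcomplete"
    and loc: "\<And>x. x \<in> M \<Longrightarrow> \<exists>r>0. compactin mtopology (mcball x r)"
    and split: "\<And>x y s t. x \<in> M \<Longrightarrow> y \<in> M \<Longrightarrow> s > 0 \<Longrightarrow> t > 0 \<Longrightarrow> d x y < s + t \<Longrightarrow>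
                  \<exists>z\<in>M. d x z < s \<and> d z y < t"
    and p: "p \<in> M"
  shows "compactin mtopology (mcball p r)"
proof (rule ccontr)
  assume r: "\<not> compactin mtopology (mcball p r)"
  define S where "S = {r. compactin mtopology (mcball p r)}"
  have down: "a \<in> S" if "b \<in> S" "a \<le> b" for a b
    using that unfolding S_def
    by (auto intro: closed_compactin[OF _ mcball_subset_concentric closedin_mcball])
  have bdd: "bdd_above S"
    using down r by (auto simp: bdd_above_def S_def intro!: exI[of _ r]) (meson linear)
  obtain r0 where r0: "r0 > 0" "r0 \<in> S"
    using loc[OF p] by (auto simp: S_def)
  define R where "R = Sup S"
  have R: "R > 0"
    using r0 cSup_upper[OF r0(2) bdd] unfolding R_def by linarith
  have below: "a \<in> S" if a: "a < R" for a
  proof -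
    have "S \<noteq> {}" using r0 by blast
    then obtain b where "b \<in> S" "a < b"
      using less_cSupE[of a S] a unfolding R_def by metis
    then show ?thesis using down by auto
  qed
  have "mtotally_bounded (mcball p R)"
    unfolding mtotally_bounded_def
  proof (intro allI impI)
    fix e :: real assume e: "e > 0"
    define R1 where "R1 = max (R/2) (R - e/4)"
    have R1: "R1 > 0" "R1 < R" "R < R1 + e/2" using R e by (auto simp: R1_def max_def)
    have "mtotally_bounded (mcball p R1)"
      using below[OF R1(2)] compactin_imp_mtotally_bounded by (auto simp: S_def)
    then obtain K where K: "finite K" "K \<subseteq> mcball p R1" "mcball p R1 \<subseteq> (\<Union>x\<in>K. mball x (e/2))"
      unfolding mtotally_bounded_def using e half_gt_zero by metis
    have "mcball p R \<subseteq> (\<Union>x\<in>K. mball x e)"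
    proof
      fix y assume "y \<in> mcball p R"
      then have y: "y \<in> M" "d p y < R1 + e/2" using R1 by auto
      obtain z where z: "z \<in> M" "d p z < R1" "d z y < e/2"
        using split[OF p y(1) R1(1) _ y(2)] e by auto
      then have "z \<in> mcball p R1" using p by auto
      then obtain k where k: "k \<in> K" "z \<in> mball k (e/2)" using K by blast
      have "d k y \<le> d k z + d z y" using k z y triangle by auto
      then have "y \<in> mball k e" using k z y by auto
      then show "y \<in> (\<Union>x\<in>K. mball x e)" using k by blast
    qed
    moreover have "K \<subseteq> mcball p R"
      using K(2) mcball_subset_concentric[of R1 R p] R1 by auto
    ultimately show "\<exists>K. finite K \<and> K \<subseteq> mcball p R \<and> mcball p R \<subseteq> (\<Union>x\<in>K. mball x e)"
      using K(1) by blast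
  qed
  then have compR: "compactin mtopology (mcball p R)"
    using mtotally_bounded_eq_compact_closure_of[OF complete] closure_of_closedin[OF closedin_mcball]
    by auto
  obtain \<rho> where \<rho>: "\<And>x. x \<in> M \<Longrightarrow> \<rho> x > 0 \<and> compactin mtopology (mcball x (\<rho> x))"
    using loc by metis
  have "\<exists>\<F>. finite \<F> \<and> \<F> \<subseteq> (\<lambda>x. mball x (\<rho> x / 2)) ` M \<and> mcball p R \<subseteq> \<Union>\<F>"
    using compR \<rho> unfolding compactin_def by (elim conjE allE impE) auto
  then obtain F where F: "finite F" "F \<subseteq> M" "mcball p R \<subseteq> (\<Union>x\<in>F. mball x (\<rho> x / 2))"
    by (metis (no_types, lifting) finite_subset_image)
  have "F \<noteq> {}" using F p R by force
  define \<delta> where "\<delta> = Min ((\<lambda>x. \<rho> x / 2) ` F)"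
  have \<delta>1: "\<delta> > 0"
    unfolding \<delta>_def using F \<rho> \<open>F \<noteq> {}\<close> by (subst Min_gr_iff) auto
  have \<delta>2: "\<delta> \<le> \<rho> x / 2" if "x \<in> F" for x
    unfolding \<delta>_def using F(1) that by (intro Min_le) auto
  note \<delta> = \<delta>1 \<delta>2
  have "mcball p (R + \<delta>/2) \<subseteq> (\<Union>x\<in>F. mcball x (\<rho> x))"
  proof
    fix y assume "y \<in> mcball p (R + \<delta>/2)"
    then have y: "y \<in> M" "d p y < R + \<delta>" using \<delta> by auto
    obtain z where z: "z \<in> M" "d p z < R" "d z y < \<delta>"
      using split[OF p y(1) R \<delta>(1) y(2)] by auto
    then have "z \<in> mcball p R" using p by auto
    then obtain k where k: "k \<in> F" "z \<in> mball k (\<rho> k / 2)" using F by blast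
    have "d k y \<le> d k z + d z y" using k z y triangle by auto
    then have "y \<in> mcball k (\<rho> k)" using k z y \<delta>(2)[OF k(1)] by auto
    then show "y \<in> (\<Union>x\<in>F. mcball x (\<rho> x))" using k by blast
  qed
  moreover have "compactin mtopology (\<Union>x\<in>F. mcball x (\<rho> x))"
    using F \<rho> by (intro compactin_Union) auto
  ultimately have "R + \<delta>/2 \<in> S"
    unfolding S_def using closed_compactin closedin_mcball by blast
  then show False
    using cSup_upper[OF _ bdd] \<delta> unfolding R_def by fastforce
qed


section \<open>Descent sequences of Kurdyka-Lojasiewicz functions\<close>

lemma concave_on_deriv_le:
  fixes \<phi> :: "real \<Rightarrow> real"
  assumes "concave_on I \<phi>" "connected I" "s \<in> interior I" "t \<in> I" "\<phi> differentiable (at s)"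
  shows "deriv \<phi> s * (s - t) \<le> \<phi> s - \<phi> t"
proof -
  have "(\<phi> has_field_derivative deriv \<phi> s) (at s)"
    using assms(5) DERIV_deriv_iff_real_differentiable by blast
  then have "((\<lambda>x. - \<phi> x) has_field_derivative - deriv \<phi> s) (at s within I)"
    using DERIV_minus DERIV_subset by blast
  from convex_on_imp_above_tangent[OF _ assms(2,3,4) this]
  show ?thesis using assms(1) by (simp add: concave_on_def algebra_simps)
qed

text \<open>
  The trapping argument. While the sequence is near the cluster point \<open>b\<close>, the decrease of the vanishing
  potential \<open>G\<close> pays for the length of each step. Started close to \<open>b\<close> with little potential left, the
  sequence thus has no means to leave a given ball around \<open>b\<close>.
\<close>

lemma (in Metric_space) descent_trapped_converges:
  fixes x :: "nat \<Rightarrow> 'a" and G :: "nat \<Rightarrow> real"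
  assumes xM: "range x \<subseteq> M" and b: "b \<in> M"
    and cluster: "\<And>e N. e > 0 \<Longrightarrow> \<exists>k\<ge>N. d (x k) b < e"
    and G0: "G \<longlonglongrightarrow> 0" and Gnn: "\<And>k. 0 \<le> G k"
    and "\<rho> > 0"
    and step: "\<And>k. k \<ge> K \<Longrightarrow> d (x k) b < \<rho> \<Longrightarrow> d (x (Suc k)) (x k) \<le> G k - G (Suc k)"
  shows "limitin mtopology x b sequentially"
  unfolding limit_metric_sequentially
proof (intro conjI b allI impI)
  fix e :: real assume "e > 0"
  define e' where "e' = min e \<rho>"
  have e': "e' > 0" using \<open>e > 0\<close> \<open>\<rho> > 0\<close> by (simp add: e'_def)
  have "\<forall>\<^sub>F k in sequentially. G k < e'/2"
    using G0 e' by (intro order_tendstoD(2)[OF G0]) auto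
  then obtain N where N: "\<And>k. k \<ge> N \<Longrightarrow> G k < e'/2" by (auto simp: eventually_sequentially)
  obtain k0 where k0: "k0 \<ge> max N K" "d (x k0) b < e'/2"
    using cluster[of "e'/2" "max N K"] e' by auto
  have xin: "x k \<in> M" for k using xM by auto
  have "d (x (k0 + j)) (x k0) \<le> G k0 - G (k0 + j)" for j
  proof (induction j)
    case 0 then show ?case using xin by simp
  next
    case (Suc j)
    have "d (x (k0+j)) b \<le> d (x (k0+j)) (x k0) + d (x k0) b"
      using triangle xin b by blast
    also have "\<dots> < e'" using Suc k0 N[of k0] Gnn[of "k0+j"] by auto
    finally have "d (x (k0+j)) b < \<rho>" by (simp add: e'_def)
    then have "d (x (Suc (k0+j))) (x (k0+j)) \<le> G (k0+j) - G (Suc (k0+j))"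
      using step k0 by auto
    moreover have "d (x (Suc (k0+j))) (x k0) \<le> d (x (Suc (k0+j))) (x (k0+j)) + d (x (k0+j)) (x k0)"
      using triangle xin by blast
    ultimately show ?case using Suc by simp
  qed
  then have "d (x (k0 + j)) b < e'" for j
  proof -
    have "d (x (k0+j)) b \<le> d (x (k0+j)) (x k0) + d (x k0) b"
      using triangle xin b by blast
    moreover have "d (x (k0 + j)) (x k0) \<le> G k0 - G (k0 + j)" by fact
    ultimately show ?thesis using k0 N[of k0] Gnn[of "k0+j"] by auto
  qed
  then have "d (x k) b < e" if "k \<ge> k0" for k
    using that by (metis e'_def le_add_diff_inverse min_less_iff_conj)
  then show "\<exists>N. \<forall>n\<ge>N. x n \<in> M \<and> d (x n) b < e" using xin by blast
qed

text \<open>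
  One step of length \<open>\<Delta>\<close>, from the gap \<open>s\<close> to the gap \<open>t\<close>, at a point with slope \<open>\<sigma>\<close>. The decrease is at least
  quadratic in \<open>\<Delta>\<close> and the slope at most linear, so the quotient of the two is at least linear:
  \<open>\<phi> s - \<phi> t \<ge> \<phi>' s * (s - t) \<ge> r1 * \<Delta>\<^sup>2 / \<sigma> \<ge> (r1 / r2) * \<Delta>\<close>, by the tangent inequality of the concave
  \<open>\<phi>\<close> and the Kurdyka-Lojasiewicz inequality \<open>\<phi>' s \<ge> 1 / \<sigma>\<close>.
\<close>

lemma KL_step_bound:
  fixes \<phi> :: "real \<Rightarrow> real"
  assumes \<phi>: "concave_on {s. 0 \<le> s \<and> ereal s < \<eta>} \<phi>"
      "\<And>s. 0 < s \<Longrightarrow> ereal s < \<eta> \<Longrightarrow> \<phi> differentiable (at s) \<and> 0 < deriv \<phi> s"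
    and s: "0 < s" "ereal s < \<eta>" and t: "0 \<le> t" 
    and decrease: "t + r1 * \<Delta>\<^sup>2 \<le> s" and slope: "\<sigma> \<le> r2 * \<Delta>"
    and KL: "deriv \<phi> s * \<sigma> \<ge> 1" and "r1 > 0" "r2 > 0" "\<Delta> \<ge> 0"
  shows "(r1 / r2) * \<Delta> \<le> \<phi> s - \<phi> t"
proof -
  let ?I = "{s. 0 \<le> s \<and> ereal s < \<eta>}"
  have "t \<le> s" using decrease \<open>r1 > 0\<close> by (smt (verit) mult_nonneg_nonneg zero_le_power2)
  then have tI: "t \<in> ?I" using t s by (auto intro: le_less_trans[of "ereal t" "ereal s"])
  have "is_interval ?I" unfolding is_interval_1
    by (auto intro: le_less_trans[of "ereal _" "ereal _"])
  then have conn: "connected ?I" by (simp add: is_interval_connected)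
  have "open {s. 0 < s \<and> ereal s < \<eta>}"
    by (intro open_Collect_conj open_Collect_less continuous_intros continuous_on_ereal)
  then have sI: "s \<in> interior ?I"
    using s by (intro interiorI[of "{s. 0 < s \<and> ereal s < \<eta>}"]) auto
  have d: "deriv \<phi> s > 0" using \<phi>(2) s by blast
  have "1 \<le> deriv \<phi> s * (r2 * \<Delta>)"
    using KL slope d by (meson mult_left_mono less_imp_le order_trans)
  then have "r1 * \<Delta> * 1 \<le> r1 * \<Delta> * (deriv \<phi> s * (r2 * \<Delta>))"
    using \<open>r1 > 0\<close> \<open>\<Delta> \<ge> 0\<close> by (intro mult_left_mono) auto
  then have "(r1 / r2) * \<Delta> \<le> deriv \<phi> s * (r1 * \<Delta>\<^sup>2)"
    using \<open>r2 > 0\<close> by (simp add: field_simps power2_eq_square)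
  also have "\<dots> \<le> deriv \<phi> s * (s - t)" using d decrease by (intro mult_left_mono) auto
  also have "\<dots> \<le> \<phi> s - \<phi> t"
    using concave_on_deriv_le[OF \<phi>(1) conn sI tI] \<phi>(2) s by blast
  finally show ?thesis .
qed

text \<open>
  Convergence of a descent sequence that has a cluster point at which the Kurdyka-Lojasiewicz
  inequality holds. If the values reach their limit, then the sequence is eventually constant;
  otherwise the inequality applies at all late times at which the sequence is near \<open>b\<close>.
\<close>

lemma (in Metric_space) KL_descent_converges:
  fixes x :: "nat \<Rightarrow> 'a" and F \<sigma> \<Delta> :: "nat \<Rightarrow> real" and \<phi> :: "real \<Rightarrow> real" and \<eta> :: ereal
  assumes xM: "range x \<subseteq> M" and b: "b \<in> M"
    and cluster: "\<And>e N. e > 0 \<Longrightarrow> \<exists>k\<ge>N. d (x k) b < e"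
    and F: "F \<longlonglongrightarrow> c"
    and decrease: "\<And>k. F (Suc k) + r1 * (\<Delta> k)\<^sup>2 \<le> F k"
    and slope: "\<And>k. \<sigma> k \<le> r2 * \<Delta> k"
    and dist: "\<And>k. s1 * d (x (Suc k)) (x k) \<le> \<Delta> k"
    and pos: "r1 > 0" "r2 > 0" "s1 > 0" "0 < \<eta>" "\<rho> > 0"
    and cont: "continuous_on {s. 0 \<le> s \<and> ereal s < \<eta>} \<phi>"
    and conc: "concave_on {s. 0 \<le> s \<and> ereal s < \<eta>} \<phi>"
    and \<phi>_nonneg: "\<And>s. 0 \<le> s \<Longrightarrow> ereal s < \<eta> \<Longrightarrow> 0 \<le> \<phi> s"
    and \<phi>_zero: "\<phi> 0 = 0"
    and deriv: "\<And>s. 0 < s \<Longrightarrow> ereal s < \<eta> \<Longrightarrow> \<phi> differentiable (at s) \<and> 0 < deriv \<phi> s"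
    and KL: "\<And>k. d (x k) b < \<rho> \<Longrightarrow> c < F k \<Longrightarrow> ereal (F k - c) < \<eta> \<Longrightarrow> deriv \<phi> (F k - c) * \<sigma> k \<ge> 1"
  shows "limitin mtopology x b sequentially"
proof -
  have xin: "x k \<in> M" for k using xM by auto
  have \<Delta>0: "\<Delta> k \<ge> 0" for k
    by (rule order_trans[OF mult_nonneg_nonneg dist]) (use \<open>s1 > 0\<close> in auto)
  have Fdec: "F (Suc k) \<le> F k" for k
    using decrease[of k] \<open>r1 > 0\<close> by (smt (verit) mult_nonneg_nonneg zero_le_power2)
  then have anti: "decseq F" by (simp add: decseq_SucI)
  then have Fc: "c \<le> F k" for k using F decseq_ge by blast
  show ?thesis
  proof (cases "\<exists>k. F k = c")
    case True
    then obtain k0 where k0: "F k0 = c" by blast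
    have const: "F k = c" if "k \<ge> k0" for k
      using decseqD[OF anti that] k0 Fc[of k] by simp
    have step0: "x (Suc k) = x k" if "k \<ge> k0" for k
    proof -
      have "F (Suc k) = F k" using const that by simp
      then have "\<Delta> k = 0" using decrease[of k] \<open>r1 > 0\<close> by (auto simp: mult_le_0_iff)
      then have "d (x (Suc k)) (x k) \<le> 0" using dist[of k] \<open>s1 > 0\<close> by (simp add: mult_le_0_iff)
      then show ?thesis using xin mdist_pos_less by fastforce
    qed
    have stays: "x k = x k0" if "k \<ge> k0" for k
      using that by (induction k rule: dec_induct) (auto simp: step0)
    show ?thesis unfolding limit_metric_sequentially
    proof (intro conjI b allI impI)
      fix e :: real assume "e > 0"
      then obtain k where "k \<ge> k0" "d (x k) b < e" using cluster by blast
      then show "\<exists>N. \<forall>n\<ge>N. x n \<in> M \<and> d (x n) b < e" using stays xin by metis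
    qed
  next
    case False
    then have gt: "c < F k" for k using Fc[of k] by (metis order_le_less)
    define C where "C = r2 / (r1 * s1)"
    have C: "C > 0" using pos by (simp add: C_def)
    have Fc0: "(\<lambda>k. F k - c) \<longlonglongrightarrow> 0" using F LIM_zero by blast
    have small: "\<forall>\<^sub>F k in sequentially. ereal (F k - c) < \<eta>"
    proof -
      have "(\<lambda>k. ereal (F k - c)) \<longlonglongrightarrow> ereal 0" using Fc0 by (intro tendsto_intros)
      then show ?thesis using \<open>0 < \<eta>\<close> by (intro order_tendstoD(2)) (auto simp: zero_ereal_def)
    qed
    then obtain K where K: "\<And>k. k \<ge> K \<Longrightarrow> ereal (F k - c) < \<eta>"
      by (auto simp: eventually_sequentially)
    \<comment> \<open>Finitely many early gaps may be outside the domain of \<open>\<phi>\<close>; the potential is set to \<open>0\<close> there.\<close>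
    define G where "G k = C * (if k \<ge> K then \<phi> (F k - c) else 0)" for k
    have "(\<lambda>k. \<phi> (F k - c)) \<longlonglongrightarrow> \<phi> 0"
      by (rule continuous_on_tendsto_compose[OF cont Fc0])
         (use \<open>0 < \<eta>\<close> small Fc in \<open>auto simp: zero_ereal_def elim: eventually_mono\<close>)
    then have "(\<lambda>k. C * \<phi> (F k - c)) \<longlonglongrightarrow> 0"
      using \<phi>_zero by (auto intro: tendsto_mult_right_zero)
    moreover have "\<forall>\<^sub>F k in sequentially. G k = C * \<phi> (F k - c)"
      using eventually_ge_at_top[of K] by eventually_elim (simp add: G_def)
    ultimately have G0: "G \<longlonglongrightarrow> 0" using tendsto_cong by force
    have Gnn: "0 \<le> G k" for k
      using C K[of k] \<phi>_nonneg[of "F k - c"] Fc[of k] by (auto simp: G_def)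
    show ?thesis
    proof (rule descent_trapped_converges[OF xM b cluster G0 Gnn \<open>\<rho> > 0\<close>, of K])
      fix k assume k: "k \<ge> K" and near: "d (x k) b < \<rho>"
      have "(r1 / r2) * \<Delta> k \<le> \<phi> (F k - c) - \<phi> (F (Suc k) - c)"
        by (rule KL_step_bound[OF conc deriv, where \<sigma> = "\<sigma> k"])
           (use gt[of k] gt[of "Suc k"] K[OF k] decrease[of k] slope[of k] KL[OF near gt K[OF k]] pos \<Delta>0
            in auto)
      moreover have "d (x (Suc k)) (x k) \<le> C * ((r1 / r2) * \<Delta> k)"
        using dist[of k] pos by (simp add: C_def field_simps)
      ultimately have "d (x (Suc k)) (x k) \<le> C * (\<phi> (F k - c) - \<phi> (F (Suc k) - c))"
        using C by (meson mult_left_mono less_imp_le order_trans)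
      then show "d (x (Suc k)) (x k) \<le> G k - G (Suc k)"
        using k by (simp add: G_def algebra_simps)
    qed auto
  qed
qed

section \<open>Tangent spaces in coordinates\<close>

lemma has_derivative_nhds_cong:
  assumes "(f has_derivative f') (at x)" "\<forall>\<^sub>F y in nhds x. f y = g y"
  shows "(g has_derivative f') (at x)"
  using assms has_derivative_transform_eventually[of f f' x UNIV g]
  by (simp add: eventually_nhds_conv_at)

lemma vec_expansion: "u = (\<Sum>i\<in>UNIV. (u $ i) *\<^sub>R axis i (1::real))" for u :: "real^'n"
  using basis_expansion[of u, symmetric] unfolding scalar_mult_eq_scaleR .

locale riemannian =
  fixes A :: "('a::{t2_space, second_countable_topology}, 'n::finite) chart set"
    and g :: "('a, 'n) metric_tensor"
  assumes manifold: "riemannian_manifold A g"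
begin

lemma atlas: "smooth_atlas A" and metric: "riemannian_metric A g"
    and connected_manifold: "connected (UNIV :: 'a set)"
  using manifold by (auto simp: riemannian_manifold_def)

lemma chart_open: "c \<in> A \<Longrightarrow> open (chart_dom c)" "c \<in> A \<Longrightarrow> open (chart_img c)"
    and chart_homeomorphism:
      "c \<in> A \<Longrightarrow> homeomorphism (chart_dom c) (chart_img c) (chart_map c) (chart_inv c)"
  using atlas by (auto simp: smooth_atlas_def)

lemma chart_around: obtains c where "c \<in> A" "p \<in> chart_dom c"
proof -
  have "(\<Union>c\<in>A. chart_dom c) = UNIV" using atlas unfolding smooth_atlas_def by blast
  then show ?thesis using that by blast
qed

lemma chart_map_in [simp]: "p \<in> chart_dom c \<Longrightarrow> chart_map c p \<in> chart_img c"
  by (auto simp: chart_img_def)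

lemma chart_inv_map [simp]: "c \<in> A \<Longrightarrow> p \<in> chart_dom c \<Longrightarrow> chart_inv c (chart_map c p) = p"
  using chart_homeomorphism by (auto simp: homeomorphism_def)

lemma chart_map_inv [simp]: "c \<in> A \<Longrightarrow> y \<in> chart_img c \<Longrightarrow> chart_map c (chart_inv c y) = y"
  using chart_homeomorphism by (auto simp: homeomorphism_def)

lemma chart_inv_in [simp]: "c \<in> A \<Longrightarrow> y \<in> chart_img c \<Longrightarrow> chart_inv c y \<in> chart_dom c"
  using chart_homeomorphism by (fastforce simp: homeomorphism_def)

lemma continuous_on_chart: "c \<in> A \<Longrightarrow> continuous_on (chart_dom c) (chart_map c)"
    and continuous_on_chart_inv: "c \<in> A \<Longrightarrow> continuous_on (chart_img c) (chart_inv c)"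
  using chart_homeomorphism by (auto simp: homeomorphism_def)

lemma open_chart_image:
  assumes "c \<in> A" "open W"
  shows "open (chart_map c ` (chart_dom c \<inter> W))"
proof -
  have "openin (top_of_set (chart_img c)) (chart_map c ` (chart_dom c \<inter> W))"
    by (rule homeomorphism_imp_open_map[OF chart_homeomorphism[OF assms(1)]])
       (use assms in \<open>auto simp: openin_open\<close>)
  then show ?thesis using chart_open(2)[OF assms(1)] openin_open_trans by blast
qed

lemma eventually_chart_inv:
  assumes "c \<in> A" "p \<in> chart_dom c" "open W" "p \<in> W"
  shows "\<forall>\<^sub>F y in nhds (chart_map c p). y \<in> chart_img c \<and> chart_inv c y \<in> W"
proof -
  have "\<forall>\<^sub>F y in nhds (chart_map c p). y \<in> chart_map c ` (chart_dom c \<inter> W)"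
    using open_chart_image[OF assms(1,3)] assms by (intro eventually_nhds_in_open) auto
  then show ?thesis by eventually_elim (use assms(1) in auto)
qed

lemma transition_has_derivative:
  assumes "c \<in> A" "c' \<in> A" "p \<in> chart_dom c" "p \<in> chart_dom c'"
  shows "((chart_map c' \<circ> chart_inv c) has_derivative transition_deriv c c' p) (at (chart_map c p))"
proof -
  have "Ck_on 1 (chart_map c ` (chart_dom c \<inter> chart_dom c')) (chart_map c' \<circ> chart_inv c)"
    using atlas assms(1,2) unfolding smooth_atlas_def smooth_on_def by blast
  then have "(chart_map c' \<circ> chart_inv c) differentiable (at (chart_map c p))"
    using assms by auto
  then show ?thesis
    unfolding transition_deriv_def using frechet_derivative_works by blast
qed

lemma linear_transition:
  assumes "c \<in> A" "c' \<in> A" "p \<in> chart_dom c" "p \<in> chart_dom c'"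
  shows "linear (transition_deriv c c' p)"
  using has_derivative_linear[OF transition_has_derivative[OF assms]] .

lemma transition_self:
  assumes "c \<in> A" "p \<in> chart_dom c"
  shows "transition_deriv c c p w = w"
proof -
  have "\<forall>\<^sub>F y in nhds (chart_map c p). y = (chart_map c \<circ> chart_inv c) y"
    using eventually_chart_inv[OF assms open_UNIV UNIV_I]
    by eventually_elim (use assms in auto)
  then have "((chart_map c \<circ> chart_inv c) has_derivative (\<lambda>w. w)) (at (chart_map c p))"
    by (rule has_derivative_nhds_cong[OF has_derivative_ident])
  from has_derivative_unique[OF transition_has_derivative this] assms
  show ?thesis by simp
qed

text \<open>
  The chain rule for a map read through another chart. For a chart map \<open>F\<close> it yields the cocycle rule of the
  transition derivatives, for a real function \<open>F\<close> the chart independence of its differential.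
\<close>

lemma transition_comp:
  assumes "c \<in> A" "c' \<in> A" "p \<in> chart_dom c" "p \<in> chart_dom c'"
    and F: "((F \<circ> chart_inv c') has_derivative F') (at (chart_map c' p))"
  shows "((F \<circ> chart_inv c) has_derivative (\<lambda>w. F' (transition_deriv c c' p w))) (at (chart_map c p))"
proof -
  have "((F \<circ> chart_inv c') has_derivative F') (at ((chart_map c' \<circ> chart_inv c) (chart_map c p)))"
    using F assms by simp
  from diff_chain_at[OF transition_has_derivative[OF assms(1-4)] this]
  have "(((F \<circ> chart_inv c') \<circ> (chart_map c' \<circ> chart_inv c)) has_derivative
          (\<lambda>w. F' (transition_deriv c c' p w))) (at (chart_map c p))"
    by (simp add: comp_def)
  moreover have "\<forall>\<^sub>F y in nhds (chart_map c p).
      ((F \<circ> chart_inv c') \<circ> (chart_map c' \<circ> chart_inv c)) y = (F \<circ> chart_inv c) y"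
    using eventually_chart_inv[OF assms(1,3) chart_open(1)[OF assms(2)] assms(4)]
    by eventually_elim (use assms in auto)
  ultimately show ?thesis
    by (rule has_derivative_nhds_cong)
qed

lemma transition_trans:
  assumes "c \<in> A" "c' \<in> A" "c'' \<in> A" "p \<in> chart_dom c" "p \<in> chart_dom c'" "p \<in> chart_dom c''"
  shows "transition_deriv c' c'' p (transition_deriv c c' p w) = transition_deriv c c'' p w"
proof -
  have "transition_deriv c c'' p = (\<lambda>w. transition_deriv c' c'' p (transition_deriv c c' p w))"
    by (rule has_derivative_unique[OF transition_has_derivative
          transition_comp[OF _ _ _ _ transition_has_derivative]]) fact+
  then show ?thesis by simp
qed

lemma tvec_of_in_tangent_space:
  assumes "c \<in> A" "p \<in> chart_dom c"
  shows "tvec_of A c p w \<in> tangent_space A p"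
  unfolding tangent_space_def mem_Collect_eq
proof (intro conjI ballI allI impI)
  fix c' c'' assume "c' \<in> A" "c'' \<in> A" "p \<in> chart_dom c' \<inter> chart_dom c''"
  then show "tvec_of A c p w c'' = transition_deriv c' c'' p (tvec_of A c p w c')"
    using assms transition_trans[of c c' c'' p w] by (simp add: tvec_of_def)
qed (auto simp: tvec_of_def)

lemma tvec_of_self [simp]:
  assumes "c \<in> A" "p \<in> chart_dom c"
  shows "tvec_of A c p w c = w"
  using assms by (simp add: tvec_of_def transition_self)

lemma tvec_of_tangent:
  assumes "c \<in> A" "p \<in> chart_dom c" "v \<in> tangent_space A p"
  shows "tvec_of A c p (v c) = v"
proof
  fix c'
  show "tvec_of A c p (v c) c' = v c'"
  proof (cases "c' \<in> A \<and> p \<in> chart_dom c'")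
    case True
    then have "v c' = transition_deriv c c' p (v c)"
      using assms unfolding tangent_space_def by blast
    then show ?thesis using True by (simp add: tvec_of_def)
  next
    case False
    then have "v c' = 0" using assms(3) unfolding tangent_space_def by blast
    then show ?thesis using False by (auto simp: tvec_of_def)
  qed
qed

lemma tvec_of_linear:
  assumes "c \<in> A" "p \<in> chart_dom c"
  shows "tvec_of A c p (a *\<^sub>R u + b *\<^sub>R w) = (\<lambda>c'. a *\<^sub>R tvec_of A c p u c' + b *\<^sub>R tvec_of A c p w c')"
  using linear_transition[OF assms(1) _ assms(2)]
  by (auto simp: tvec_of_def linear_add linear_scale)

lemma zero_in_tangent_space: "(\<lambda>_. 0) \<in> tangent_space A p"
  using linear_transition by (auto simp: tangent_space_def linear_0)

lemma tangent_space_lincomb: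
  assumes "u \<in> tangent_space A p" "v \<in> tangent_space A p"
  shows "(\<lambda>c. a *\<^sub>R u c + b *\<^sub>R v c) \<in> tangent_space A p"
proof -
  obtain c where c: "c \<in> A" "p \<in> chart_dom c" by (rule chart_around)
  have "tvec_of A c p (a *\<^sub>R u c + b *\<^sub>R v c) \<in> tangent_space A p"
    by (rule tvec_of_in_tangent_space[OF c])
  then show ?thesis
    by (simp add: tvec_of_linear[OF c] tvec_of_tangent[OF c assms(1)] tvec_of_tangent[OF c assms(2)])
qed

lemma metric_sym:
  assumes "u \<in> tangent_space A p" "v \<in> tangent_space A p"
  shows "g p u v = g p v u"
  using metric assms unfolding riemannian_metric_def by blast

lemma metric_linear:
  assumes "u \<in> tangent_space A p" "v \<in> tangent_space A p" "w \<in> tangent_space A p"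
  shows "g p (\<lambda>c. a *\<^sub>R u c + b *\<^sub>R v c) w = a * g p u w + b * g p v w"
  using metric assms unfolding riemannian_metric_def by blast

lemma metric_pos:
  assumes "u \<in> tangent_space A p" "u \<noteq> (\<lambda>_. 0)"
  shows "g p u u > 0"
  using metric assms unfolding riemannian_metric_def by blast

lemma metric_zero [simp]: "g p (\<lambda>_. 0) (\<lambda>_. 0) = 0"
  using metric_linear[OF zero_in_tangent_space zero_in_tangent_space zero_in_tangent_space, of p 0 0]
  by simp

lemma metric_nonneg: "u \<in> tangent_space A p \<Longrightarrow> g p u u \<ge> 0"
  using metric_pos[of u p] by (cases "u = (\<lambda>_. 0)") auto

lemma tnorm_nonneg: "u \<in> tangent_space A p \<Longrightarrow> tnorm g p u \<ge> 0"
  by (simp add: tnorm_def metric_nonneg)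

definition coord_metric :: "('a, 'n) chart \<Rightarrow> 'a \<Rightarrow> real^'n \<Rightarrow> real^'n \<Rightarrow> real" where
  "coord_metric c p u w = g p (tvec_of A c p u) (tvec_of A c p w)"

lemma bilinear_coord_metric:
  assumes "c \<in> A" "p \<in> chart_dom c"
  shows "bilinear (coord_metric c p)"
proof -
  note T = tvec_of_in_tangent_space[OF assms]
  have left: "coord_metric c p (a *\<^sub>R u + b *\<^sub>R v) w = a * coord_metric c p u w + b * coord_metric c p v w"
    for a b u v w
    unfolding coord_metric_def tvec_of_linear[OF assms] by (rule metric_linear[OF T T T])
  have sym: "coord_metric c p u w = coord_metric c p w u" for u w
    unfolding coord_metric_def by (rule metric_sym[OF T T])
  have "linear (\<lambda>u. coord_metric c p u w)" for w
    using left[of 1 _ 1 _ w] left[of _ _ 0 0 w] by (auto intro!: linearI)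
  moreover have "linear (coord_metric c p u)" for u
    using \<open>linear (\<lambda>v. coord_metric c p v u)\<close> by (subst (asm) sym) simp
  ultimately show ?thesis unfolding bilinear_def by blast
qed

lemma coord_metric_pos:
  assumes "c \<in> A" "p \<in> chart_dom c" "w \<noteq> 0"
  shows "coord_metric c p w w > 0"
proof -
  have "tvec_of A c p w \<noteq> (\<lambda>_. 0)" using tvec_of_self[OF assms(1,2), of w] assms(3) by metis
  then show ?thesis
    unfolding coord_metric_def by (intro metric_pos tvec_of_in_tangent_space assms)
qed

lemma metric_eq_coord_metric:
  assumes "c \<in> A" "p \<in> chart_dom c" "u \<in> tangent_space A p" "v \<in> tangent_space A p"
  shows "g p u v = coord_metric c p (u c) (v c)"
  unfolding coord_metric_def using tvec_of_tangent[OF assms(1,2)] assms by simp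

lemma coord_metric_eq_sum:
  assumes "c \<in> A" "p \<in> chart_dom c"
  shows "coord_metric c p u w =
    (\<Sum>i\<in>UNIV. \<Sum>j\<in>UNIV. u $ i * w $ j * metric_matrix A g c (chart_map c p) $ i $ j)"
proof -
  have "coord_metric c p u w =
      coord_metric c p (\<Sum>i\<in>UNIV. (u $ i) *\<^sub>R axis i 1) (\<Sum>j\<in>UNIV. (w $ j) *\<^sub>R axis j 1)"
    by (rule arg_cong2[where f = "coord_metric c p", OF vec_expansion vec_expansion])
  also have "\<dots> = (\<Sum>(i,j)\<in>UNIV \<times> UNIV. coord_metric c p ((u $ i) *\<^sub>R axis i 1) ((w $ j) *\<^sub>R axis j 1))"
    by (rule bilinear_sum[OF bilinear_coord_metric[OF assms]])
  also have "\<dots> = (\<Sum>(i,j)\<in>UNIV \<times> UNIV. u $ i * w $ j * coord_metric c p (axis i 1) (axis j 1))"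
    using bilinear_lmul[OF bilinear_coord_metric[OF assms]] bilinear_rmul[OF bilinear_coord_metric[OF assms]]
    by (simp add: mult_ac)
  also have "\<dots> = (\<Sum>i\<in>UNIV. \<Sum>j\<in>UNIV. u $ i * w $ j * coord_metric c p (axis i 1) (axis j 1))"
    by (simp add: sum.cartesian_product)
  finally show ?thesis
    using assms by (simp add: metric_matrix_def coord_metric_def Let_def)
qed

lemma continuous_on_metric_matrix:
  assumes "c \<in> A"
  shows "continuous_on (chart_img c) (\<lambda>y. metric_matrix A g c y $ i $ j)"
proof -
  have "Ck_on 0 (chart_img c) (\<lambda>y. metric_matrix A g c y $ i $ j)"
    using metric assms unfolding riemannian_metric_def smooth_on_def by blast
  then show ?thesis by simp
qed

lemma continuous_on_coord_metric:
  assumes c: "c \<in> A" and p: "continuous_on S p" "\<And>t. t \<in> S \<Longrightarrow> p t \<in> chart_dom c"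
    and u: "continuous_on S u" and w: "continuous_on S w"
  shows "continuous_on S (\<lambda>t. coord_metric c (p t) (u t) (w t))"
proof -
  have "continuous_on S (\<lambda>t. chart_map c (p t))"
    by (rule continuous_on_compose2[OF continuous_on_chart[OF c] p(1)]) (use p(2) in auto)
  then have mm: "continuous_on S (\<lambda>t. metric_matrix A g c (chart_map c (p t)) $ i $ j)" for i j
    by (rule continuous_on_compose2[OF continuous_on_metric_matrix[OF c]]) (use p(2) in auto)
  have "continuous_on S (\<lambda>t. \<Sum>i\<in>UNIV. \<Sum>j\<in>UNIV.
      u t $ i * w t $ j * metric_matrix A g c (chart_map c (p t)) $ i $ j)"
    by (intro continuous_on_sum continuous_on_mult mm continuous_on_component[OF u] continuous_on_component[OF w])
  then show ?thesis
    using p(2) by (subst continuous_on_cong[OF refl coord_metric_eq_sum[OF c]]) auto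
qed

text \<open>
  The metric is continuous and positive on the product of the compact set and the Euclidean unit sphere,
  hence bounded there from above and away from zero; homogeneity extends the bounds to all vectors.
\<close>

lemma tnorm_local_bounds:
  assumes c: "c \<in> A" and K: "compact K" "K \<subseteq> chart_img c"
  obtains m M where "m > 0" "M > 0"
    "\<And>p v. p \<in> chart_dom c \<Longrightarrow> chart_map c p \<in> K \<Longrightarrow> v \<in> tangent_space A p \<Longrightarrow>
       m * norm (v c) \<le> tnorm g p v \<and> tnorm g p v \<le> M * norm (v c)"
proof (cases "K = {}")
  case True then show ?thesis using that[of 1 1] by auto
next
  case False
  define S where "S = K \<times> sphere (0 :: real^'n) 1"
  define Q where "Q z = coord_metric c (chart_inv c (fst z)) (snd z) (snd z)" for z
  have S: "compact S" "S \<noteq> {}" using K False by (auto simp: S_def compact_Times)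
  have inv: "continuous_on S (\<lambda>z. chart_inv c (fst z))"
    by (rule continuous_on_compose2[OF continuous_on_chart_inv[OF c]])
       (use K in \<open>auto simp: S_def intro!: continuous_intros\<close>)
  have Q: "continuous_on S Q"
    unfolding Q_def
    by (rule continuous_on_coord_metric[OF c inv])
       (use K c in \<open>auto simp: S_def intro!: continuous_intros\<close>)
  obtain z1 where z1: "z1 \<in> S" "\<And>z. z \<in> S \<Longrightarrow> Q z1 \<le> Q z"
    using continuous_attains_inf[OF S Q] by blast
  obtain z2 where z2: "z2 \<in> S" "\<And>z. z \<in> S \<Longrightarrow> Q z \<le> Q z2"
    using continuous_attains_sup[OF S Q] by blast
  have pos: "Q z > 0" if "z \<in> S" for z
    unfolding Q_def using that K c by (intro coord_metric_pos) (auto simp: S_def)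
  show ?thesis
  proof (rule that[of "sqrt (Q z1)" "sqrt (Q z2)"])
    fix p v assume p: "p \<in> chart_dom c" "chart_map c p \<in> K" and v: "v \<in> tangent_space A p"
    show "sqrt (Q z1) * norm (v c) \<le> tnorm g p v \<and> tnorm g p v \<le> sqrt (Q z2) * norm (v c)"
    proof (cases "v c = 0")
      case True
      then show ?thesis
        using metric_eq_coord_metric[OF c p(1) v v] bilinear_lzero[OF bilinear_coord_metric[OF c p(1)]]
        by (simp add: tnorm_def)
    next
      case False
      define u where "u = (1 / norm (v c)) *\<^sub>R v c"
      have "norm u = 1" using False by (simp add: u_def)
      then have uS: "(chart_map c p, u) \<in> S" using p by (simp add: S_def)
      have vu: "v c = norm (v c) *\<^sub>R u" using False by (simp add: u_def)
      have "g p v v = coord_metric c p (norm (v c) *\<^sub>R u) (norm (v c) *\<^sub>R u)"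
        using metric_eq_coord_metric[OF c p(1) v v] vu by simp
      also have "\<dots> = (norm (v c))\<^sup>2 * Q (chart_map c p, u)"
        using c p bilinear_lmul[OF bilinear_coord_metric[OF c p(1)]]
          bilinear_rmul[OF bilinear_coord_metric[OF c p(1)]]
        by (simp add: Q_def power2_eq_square)
      finally have "tnorm g p v = norm (v c) * sqrt (Q (chart_map c p, u))"
        by (simp add: tnorm_def real_sqrt_mult)
      then show ?thesis
        using z1(2)[OF uS] z2(2)[OF uS]
        by (simp add: mult.commute[of _ "norm (v c)"] mult_left_mono)
    qed
  qed (use pos z1 z2 in auto)
qed


section \<open>Gradients of continuously differentiable functions\<close>

lemma C1_has_derivative:
  assumes "C1_fun A h" "c \<in> A" "p \<in> chart_dom c"
  shows "((h \<circ> chart_inv c) has_derivative frechet_derivative (h \<circ> chart_inv c) (at (chart_map c p)))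
    (at (chart_map c p))"
proof -
  have "(h \<circ> chart_inv c) differentiable (at (chart_map c p))"
    using assms by (auto simp: C1_fun_def)
  then show ?thesis using frechet_derivative_works by blast
qed

lemma C1_differential_chart_indep:
  assumes "C1_fun A h" "c \<in> A" "p \<in> chart_dom c" "c' \<in> A" "p \<in> chart_dom c'" "v \<in> tangent_space A p"
  shows "frechet_derivative (h \<circ> chart_inv c) (at (chart_map c p)) (v c) =
         frechet_derivative (h \<circ> chart_inv c') (at (chart_map c' p)) (v c')"
proof -
  have "v c' = transition_deriv c c' p (v c)"
    using assms unfolding tangent_space_def by blast
  then show ?thesis
    using has_derivative_unique[OF C1_has_derivative[OF assms(1,2,3)]
        transition_comp[OF assms(2,4,3,5) C1_has_derivative[OF assms(1,4,5)]]]
    by simp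
qed

lemma C1_continuous:
  assumes "C1_fun A h"
  shows "isCont h p"
proof -
  obtain c where c: "c \<in> A" "p \<in> chart_dom c" by (rule chart_around)
  have "continuous_on (chart_img c) (h \<circ> chart_inv c)"
    using assms c differentiable_imp_continuous_within
    by (fastforce simp: C1_fun_def intro!: continuous_at_imp_continuous_on)
  then have "continuous_on (chart_dom c) ((h \<circ> chart_inv c) \<circ> chart_map c)"
    using continuous_on_compose[OF continuous_on_chart[OF c(1)]] by (simp add: chart_img_def)
  then have "continuous_on (chart_dom c) h"
    by (rule continuous_on_eq) (use c in auto)
  then show ?thesis using c chart_open continuous_on_eq_continuous_at by blast
qed

text \<open>
  The gradient exists by the Riesz representation in one chart; the metric being positive definite, the
  linear map that sends a coordinate vector to its pairings with the basis is injective, hence onto.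
\<close>

lemma grad_in_tangent_space:
  assumes h: "C1_fun A h"
  shows "grad A g h p \<in> tangent_space A p"
proof -
  obtain c where c: "c \<in> A" "p \<in> chart_dom c" by (rule chart_around)
  let ?B = "coord_metric c p"
  let ?D = "\<lambda>c. frechet_derivative (h \<circ> chart_inv c) (at (chart_map c p))"
  let ?P = "\<lambda>w. w \<in> tangent_space A p \<and>
     (\<forall>v\<in>tangent_space A p. \<forall>c\<in>A. p \<in> chart_dom c \<longrightarrow> g p w v = ?D c (v c))"
  note bil = bilinear_coord_metric[OF c]
  define T where "T w = (\<chi> i. ?B w (axis i 1))" for w
  have expand: "F w = (\<Sum>i\<in>UNIV. w $ i * F (axis i 1))" if F: "linear F" for F :: "real^'n \<Rightarrow> real" and w
  proof -
    have "F w = F (\<Sum>i\<in>UNIV. (w $ i) *\<^sub>R axis i 1)"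
      by (rule arg_cong[where f = F, OF vec_expansion])
    then show ?thesis using F by (simp add: linear_sum linear_scale)
  qed
  have linB: "linear (?B w)" for w using bil by (simp add: bilinear_def)
  have "linear T"
    by (rule linearI) (simp_all add: T_def vec_eq_iff bilinear_ladd[OF bil] bilinear_lmul[OF bil])
  moreover have "inj T"
    unfolding linear_injective_0[OF \<open>linear T\<close>]
  proof (intro allI impI)
    fix w assume "T w = 0"
    then have "?B w (axis i 1) = 0" for i by (simp add: T_def vec_eq_iff)
    then have "?B w w = 0" using expand[OF linB, of w w] by simp
    then show "w = 0" using coord_metric_pos[OF c, of w] by force
  qed
  ultimately obtain w where w: "T w = (\<chi> i. ?D c (axis i 1))"
    using linear_injective_imp_surjective by (metis surj_def)
  have linD: "linear (?D c)" using has_derivative_linear[OF C1_has_derivative[OF h c]] .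
  have rep: "?B w v = ?D c v" for v
    using w expand[OF linB, of w v] expand[OF linD, of v] by (simp add: T_def vec_eq_iff)
  have "?P (tvec_of A c p w)"
    using metric_eq_coord_metric[OF c tvec_of_in_tangent_space[OF c]] rep
      C1_differential_chart_indep[OF h c] tvec_of_in_tangent_space[OF c] tvec_of_self[OF c]
    by metis
  moreover have "u = u'" if u: "?P u" and u': "?P u'" for u u'
  proof -
    define z where "z = (\<lambda>c. 1 *\<^sub>R u c + (-1) *\<^sub>R u' c)"
    have z: "z \<in> tangent_space A p" unfolding z_def using u u' by (intro tangent_space_lincomb) auto
    have "g p u z = g p u' z" using u u' z c by metis
    then have "g p z z = 0"
      unfolding z_def using metric_linear[of u p u' z 1 "-1"] u u' z by (simp add: z_def)
    then have "z = (\<lambda>_. 0)" using metric_pos[OF z] by force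
    then have "z c = 0" for c by simp
    then have "u c = u' c" for c unfolding z_def by (simp only: right_minus_eq scaleR_one scaleR_minus1_left flip: diff_conv_add_uminus)
    then show "u = u'" by (rule ext)
  qed
  ultimately have "\<exists>!w. ?P w" by blast
  from theI'[OF this] show ?thesis unfolding grad_def by blast
qed

text \<open>
  A continuously differentiable function is its own test function, so its gradient is a subgradient. This
  half of the identity \<open>\<partial>f = {grad f}\<close> bounds the distance of \<open>0\<close> from the subdifferential by the norm
  of the gradient.
\<close>

lemma grad_in_frechet_subdiff:
  assumes "C1_fun A h"
  shows "grad A g h p \<in> frechet_subdiff A g (\<lambda>p. ereal (h p)) p"
  unfolding frechet_subdiff_def using assms by (auto intro!: exI[of _ h] exI[of _ UNIV])

lemma grad_in_limiting_subdiff: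
  assumes "C1_fun A h"
  shows "grad A g h p \<in> limiting_subdiff A g (\<lambda>p. ereal (h p)) p"
  unfolding limiting_subdiff_def TM_tendsto_def
  using assms grad_in_frechet_subdiff[OF assms] grad_in_tangent_space[OF assms]
  by (auto intro!: exI[of _ "\<lambda>_. p"] exI[of _ "\<lambda>_. grad A g h p"])

lemma dist0_subdiff_le_tnorm_grad:
  assumes "C1_fun A h"
  shows "dist0_subdiff A g (\<lambda>p. ereal (h p)) p \<le> ereal (tnorm g p (grad A g h p))"
  unfolding dist0_subdiff_def by (rule INF_lower[OF grad_in_limiting_subdiff[OF assms]])

text \<open>
  Near \<open>b\<close> the coordinates of the gradients are controlled by their norms with a uniform constant, so
  the gradients converge to the zero vector at \<open>b\<close> in the tangent bundle.
\<close>

lemma critical_point_of_grad_tendsto_0: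
  assumes h: "C1_fun A h" and x: "x \<longlonglongrightarrow> b"
    and small: "(\<lambda>k. tnorm g (x k) (grad A g h (x k))) \<longlonglongrightarrow> 0"
  shows "critical_point A g (\<lambda>p. ereal (h p)) b"
proof -
  have lim: "(\<lambda>k. grad A g h (x k) c) \<longlonglongrightarrow> 0" if c: "c \<in> A" "b \<in> chart_dom c" for c
  proof -
    obtain r where r: "r > 0" "cball (chart_map c b) r \<subseteq> chart_img c"
      using chart_open(2)[OF c(1)] chart_map_in[OF c(2)] open_contains_cball by blast
    obtain m M where m: "m > 0"
      "\<And>p v. p \<in> chart_dom c \<Longrightarrow> chart_map c p \<in> cball (chart_map c b) r \<Longrightarrow> v \<in> tangent_space A p \<Longrightarrow>
         m * norm (v c) \<le> tnorm g p v \<and> tnorm g p v \<le> M * norm (v c)"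
      using tnorm_local_bounds[OF c(1) compact_cball r(2)] by metis
    have dom: "\<forall>\<^sub>F k in sequentially. x k \<in> chart_dom c"
      using topological_tendstoD[OF x chart_open(1)[OF c(1)] c(2)] .
    have "isCont (chart_map c) b"
      using continuous_on_chart[OF c(1)] c chart_open continuous_on_eq_continuous_at by blast
    then have "(\<lambda>k. chart_map c (x k)) \<longlonglongrightarrow> chart_map c b"
      using x isCont_tendsto_compose by blast
    then have "\<forall>\<^sub>F k in sequentially. chart_map c (x k) \<in> ball (chart_map c b) r"
      using r by (intro topological_tendstoD[OF _ open_ball]) auto
    with dom have "\<forall>\<^sub>F k in sequentially.
        norm (grad A g h (x k) c) \<le> tnorm g (x k) (grad A g h (x k)) / m"
      by eventually_elim
         (use m grad_in_tangent_space[OF h] in \<open>force simp: field_simps\<close>)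
    moreover have "(\<lambda>k. tnorm g (x k) (grad A g h (x k)) / m) \<longlonglongrightarrow> 0"
      using tendsto_divide[OF small tendsto_const[of m]] m by simp
    ultimately show ?thesis by (rule Lim_null_comparison)
  qed
  have "(\<lambda>k. ereal (h (x k))) \<longlonglongrightarrow> ereal (h b)"
    using C1_continuous[OF h] x by (intro tendsto_intros isCont_tendsto_compose[of b h]) auto
  then show ?thesis
    unfolding critical_point_def limiting_subdiff_def TM_tendsto_def
    using x lim grad_in_tangent_space[OF h] grad_in_frechet_subdiff[OF h] zero_in_tangent_space
    by (auto intro!: exI[of _ x] exI[of _ "\<lambda>k. grad A g h (x k)"])
qed

end

section \<open>Piecewise continuously differentiable curves and their lengths\<close>

context riemannian
begin

text \<open>
  On a nondegenerate interval one-sided derivatives are unique, so that continuous differentiability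
  can be shown by exhibiting the derivative.
\<close>

lemma C1_curveI:
  assumes "a < b" "continuous_on {a..b} \<gamma>"
    and "\<And>c. c \<in> A \<Longrightarrow> \<exists>D. (\<forall>t\<in>{a..b}. \<gamma> t \<in> chart_dom c \<longrightarrow>
            ((chart_map c \<circ> \<gamma>) has_vector_derivative D t) (at t within {a..b})) \<and>
          continuous_on {t\<in>{a..b}. \<gamma> t \<in> chart_dom c} D"
  shows "C1_curve A {a..b} \<gamma>"
  unfolding C1_curve_def Let_def
proof (intro conjI ballI assms(2))
  fix c assume "c \<in> A"
  let ?J = "{t\<in>{a..b}. \<gamma> t \<in> chart_dom c}"
  obtain D where D: "\<And>t. t \<in> ?J \<Longrightarrow> ((chart_map c \<circ> \<gamma>) has_vector_derivative D t) (at t within {a..b})"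
      and cont: "continuous_on ?J D"
    using assms(3)[OF \<open>c \<in> A\<close>] by blast
  show "(chart_map c \<circ> \<gamma>) differentiable (at t within {a..b})" if "t \<in> ?J" for t
    using D[OF that] differentiableI_vector by blast
  have "vector_derivative (chart_map c \<circ> \<gamma>) (at t within {a..b}) = D t" if "t \<in> ?J" for t
    using vector_derivative_within_closed_interval[OF assms(1) _ D[OF that]] that by simp
  then show "continuous_on ?J (\<lambda>t. vector_derivative (chart_map c \<circ> \<gamma>) (at t within {a..b}))"
    by (intro continuous_on_eq[OF cont]) simp
qed

lemma C1_curve_continuous: "C1_curve A I \<gamma> \<Longrightarrow> continuous_on I \<gamma>"
  by (simp add: C1_curve_def)

lemma C1_curve_has_vector_derivative:
  assumes "C1_curve A I \<gamma>" "c \<in> A" "t \<in> I" "\<gamma> t \<in> chart_dom c"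
  shows "((chart_map c \<circ> \<gamma>) has_vector_derivative velocity A I \<gamma> t c) (at t within I)"
  using assms by (auto simp: C1_curve_def velocity_def Let_def vector_derivative_works)

lemma C1_curve_velocity_continuous:
  assumes "C1_curve A I \<gamma>" "c \<in> A"
  shows "continuous_on {t\<in>I. \<gamma> t \<in> chart_dom c} (\<lambda>t. velocity A I \<gamma> t c)"
proof -
  have "continuous_on {t\<in>I. \<gamma> t \<in> chart_dom c} (\<lambda>t. vector_derivative (chart_map c \<circ> \<gamma>) (at t within I))"
    using assms by (auto simp: C1_curve_def Let_def)
  then show ?thesis
    by (rule continuous_on_eq) (use assms in \<open>auto simp: velocity_def\<close>)
qed

lemma C1_curve_affine:
  assumes C1: "C1_curve A {a..b} \<gamma>" and "a' < b'" and into: "(\<lambda>t. k * t + s) ` {a'..b'} \<subseteq> {a..b}"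
  shows "C1_curve A {a'..b'} (\<lambda>t. \<gamma> (k * t + s))"
proof (rule C1_curveI[OF \<open>a' < b'\<close>])
  have in_ab: "k * t + s \<in> {a..b}" if "t \<in> {a'..b'}" for t using into that by blast
  show "continuous_on {a'..b'} (\<lambda>t. \<gamma> (k * t + s))"
    by (rule continuous_on_compose2[OF C1_curve_continuous[OF C1] _ into]) (intro continuous_intros)
  fix c assume c: "c \<in> A"
  let ?D = "\<lambda>t. k *\<^sub>R velocity A {a..b} \<gamma> (k * t + s) c"
  have vd: "((chart_map c \<circ> (\<lambda>t. \<gamma> (k * t + s))) has_vector_derivative ?D t) (at t within {a'..b'})"
    if "t \<in> {a'..b'}" "\<gamma> (k * t + s) \<in> chart_dom c" for t
  proof -
    have "((chart_map c \<circ> \<gamma>) has_vector_derivative velocity A {a..b} \<gamma> (k * t + s) c)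
        (at (k * t + s) within (\<lambda>t. k * t + s) ` {a'..b'})"
      by (rule has_vector_derivative_within_subset[OF C1_curve_has_vector_derivative[OF C1 c] into])
         (use in_ab that in auto)
    moreover have "((\<lambda>t. k * t + s) has_vector_derivative k) (at t within {a'..b'})"
      by (auto intro!: derivative_eq_intros)
    ultimately show ?thesis
      using vector_diff_chain_within[of "\<lambda>t. k * t + s" k t "{a'..b'}" "chart_map c \<circ> \<gamma>"]
      by (simp add: comp_def)
  qed
  have "continuous_on {t\<in>{a'..b'}. \<gamma> (k * t + s) \<in> chart_dom c}
      (\<lambda>t. velocity A {a..b} \<gamma> (k * t + s) c)"
  proof (rule continuous_on_compose2[OF C1_curve_velocity_continuous[OF C1 c],
        where f = "\<lambda>t. k * t + s"])
    show "(\<lambda>t. k * t + s) ` {t\<in>{a'..b'}. \<gamma> (k * t + s) \<in> chart_dom c} \<subseteq> {t\<in>{a..b}. \<gamma> t \<in> chart_dom c}"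
      using in_ab by blast
  qed (intro continuous_intros)
  then have "continuous_on {t\<in>{a'..b'}. \<gamma> (k * t + s) \<in> chart_dom c} ?D"
    by (intro continuous_on_scaleR continuous_on_const)
  then show "\<exists>D. (\<forall>t\<in>{a'..b'}. \<gamma> (k * t + s) \<in> chart_dom c \<longrightarrow>
            ((chart_map c \<circ> (\<lambda>t. \<gamma> (k * t + s))) has_vector_derivative D t) (at t within {a'..b'})) \<and>
          continuous_on {t\<in>{a'..b'}. \<gamma> (k * t + s) \<in> chart_dom c} D"
    using vd by (intro exI[of _ ?D]) simp
qed

lemma C1_curve_subinterval:
  assumes "C1_curve A {a..b} \<gamma>" "a \<le> a'" "a' < b'" "b' \<le> b"
  shows "C1_curve A {a'..b'} \<gamma>"
  using C1_curve_affine[of a b \<gamma> a' b' 1 0] assms by simp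

lemma C1_curve_cong:
  assumes "C1_curve A {a..b} \<gamma>" "a < b" and eq: "\<And>t. t \<in> {a..b} \<Longrightarrow> \<delta> t = \<gamma> t"
  shows "C1_curve A {a..b} \<delta>"
proof (rule C1_curveI[OF \<open>a < b\<close>])
  show "continuous_on {a..b} \<delta>"
    by (rule continuous_on_eq[OF C1_curve_continuous[OF assms(1)]]) (simp add: eq)
  fix c assume c: "c \<in> A"
  have "((chart_map c \<circ> \<delta>) has_vector_derivative velocity A {a..b} \<gamma> t c) (at t within {a..b})"
    if "t \<in> {a..b}" "\<delta> t \<in> chart_dom c" for t
    using that eq
    by (intro has_vector_derivative_transform[OF that(1) _ C1_curve_has_vector_derivative[OF assms(1) c]])
       auto
  moreover have "{t\<in>{a..b}. \<delta> t \<in> chart_dom c} = {t\<in>{a..b}. \<gamma> t \<in> chart_dom c}"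
    using eq by auto
  ultimately show "\<exists>D. (\<forall>t\<in>{a..b}. \<delta> t \<in> chart_dom c \<longrightarrow>
            ((chart_map c \<circ> \<delta>) has_vector_derivative D t) (at t within {a..b})) \<and>
          continuous_on {t\<in>{a..b}. \<delta> t \<in> chart_dom c} D"
    using C1_curve_velocity_continuous[OF assms(1) c]
    by (intro exI[of _ "\<lambda>t. velocity A {a..b} \<gamma> t c"]) simp
qed

text \<open>
  The inductive form of piecewise continuous differentiability, in which curves are taken apart and
  composed by rule induction.
\<close>

inductive C1_chain :: "(real \<Rightarrow> 'a) \<Rightarrow> real \<Rightarrow> real \<Rightarrow> bool" for \<gamma> where
  refl: "C1_chain \<gamma> a a"
| step: "a < b \<Longrightarrow> C1_curve A {a..b} \<gamma> \<Longrightarrow> C1_chain \<gamma> b c \<Longrightarrow> C1_chain \<gamma> a c"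

lemma piecewise_C1_curve_iff_C1_chain: "piecewise_C1_curve A a b \<gamma> \<longleftrightarrow> C1_chain \<gamma> a b"
proof
  have "C1_chain \<gamma> (\<tau> 0) (\<tau> m)"
    if "\<forall>i<m. \<tau> i < \<tau> (Suc i) \<and> C1_curve A {\<tau> i..\<tau> (Suc i)} \<gamma>" for m :: nat and \<tau>
    using that
  proof (induction m arbitrary: \<tau>)
    case 0 show ?case by (rule C1_chain.refl)
  next
    case (Suc m)
    have "C1_chain \<gamma> (\<tau> (Suc 0)) (\<tau> (Suc m))"
      using Suc.IH[of "\<lambda>i. \<tau> (Suc i)"] Suc.prems by simp
    then show ?case using Suc.prems by (intro C1_chain.step[of "\<tau> 0" "\<tau> (Suc 0)"]) auto
  qed
  then show "piecewise_C1_curve A a b \<gamma> \<Longrightarrow> C1_chain \<gamma> a b"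
    unfolding piecewise_C1_curve_def by metis
  show "C1_chain \<gamma> a b \<Longrightarrow> piecewise_C1_curve A a b \<gamma>"
  proof (induction rule: C1_chain.induct)
    case (refl a)
    show ?case unfolding piecewise_C1_curve_def by (intro exI[of _ 0] exI[of _ "\<lambda>_. a"]) simp
  next
    case (step a b c)
    then obtain m and \<tau> :: "nat \<Rightarrow> real" where \<tau>: "\<tau> 0 = b" "\<tau> m = c"
      "\<And>i. i < m \<Longrightarrow> \<tau> i < \<tau> (Suc i) \<and> C1_curve A {\<tau> i..\<tau> (Suc i)} \<gamma>"
      unfolding piecewise_C1_curve_def by auto
    show ?case unfolding piecewise_C1_curve_def
      by (intro exI[of _ "Suc m"] exI[of _ "case_nat a \<tau>"])
         (use \<tau> step in \<open>auto simp: less_Suc_eq_0_disj\<close>)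
  qed
qed

lemma C1_chain_le: "C1_chain \<gamma> a b \<Longrightarrow> a \<le> b"
  by (induction rule: C1_chain.induct) auto

lemma C1_chain_single: "a < b \<Longrightarrow> C1_curve A {a..b} \<gamma> \<Longrightarrow> C1_chain \<gamma> a b"
  by (rule C1_chain.step[OF _ _ C1_chain.refl])

lemma C1_chain_trans: "C1_chain \<gamma> a b \<Longrightarrow> C1_chain \<gamma> b c \<Longrightarrow> C1_chain \<gamma> a c"
  by (induction rule: C1_chain.induct) (auto intro: C1_chain.step)

lemma C1_chain_cong:
  assumes "C1_chain \<gamma> a b" "\<And>t. t \<in> {a..b} \<Longrightarrow> \<delta> t = \<gamma> t"
  shows "C1_chain \<delta> a b"
  using assms
proof (induction rule: C1_chain.induct)
  case (refl a) show ?case by (rule C1_chain.refl)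
next
  case (step a b c)
  have "b \<le> c" by (rule C1_chain_le) fact
  show ?case
  proof (rule C1_chain.step[OF step(1)])
    show "C1_curve A {a..b} \<delta>"
      by (rule C1_curve_cong[OF step(2,1)]) (use step.prems \<open>b \<le> c\<close> in auto)
    show "C1_chain \<delta> b c"
      by (rule step.IH) (use step.prems \<open>a < b\<close> in auto)
  qed
qed

lemma C1_chain_split:
  assumes "C1_chain \<gamma> a b" "t \<in> {a..b}"
  shows "C1_chain \<gamma> a t \<and> C1_chain \<gamma> t b"
  using assms
proof (induction rule: C1_chain.induct)
  case (refl a) then show ?case by (auto intro: C1_chain.refl)
next
  case (step a b c)
  have "t = a \<or> (a < t \<and> t < b) \<or> t = b \<or> b < t" using step.prems by auto
  then consider "t = a" | "a < t" "t < b" | "t = b" | "b < t" by blast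
  then show ?case
  proof cases
    case 1 then show ?thesis using step by (auto intro: C1_chain.intros)
  next
    case 2
    then have "C1_chain \<gamma> a t" "C1_chain \<gamma> t b"
      using step by (auto intro!: C1_chain_single C1_curve_subinterval[of a b \<gamma>])
    then show ?thesis using step C1_chain_trans by blast
  next
    case 3 then show ?thesis using step by (auto intro: C1_chain_single)
  next
    case 4
    then have "t \<in> {b..c}" using step by auto
    then show ?thesis using step C1_chain.step by blast
  qed
qed

lemma C1_chain_shift:
  assumes "C1_chain \<gamma> a b"
  shows "C1_chain (\<lambda>t. \<gamma> (t + s)) (a - s) (b - s)"
  using assms
proof (induction rule: C1_chain.induct)
  case (refl a) show ?case by (rule C1_chain.refl)
next
  case (step a b c)
  then show ?case
    using C1_curve_affine[of a b \<gamma> "a - s" "b - s" 1 s]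
    by (intro C1_chain.step[of "a - s" "b - s"]) auto
qed

lemma C1_chain_reverse:
  assumes "C1_chain \<gamma> a b"
  shows "C1_chain (\<lambda>t. \<gamma> (- t)) (- b) (- a)"
  using assms
proof (induction rule: C1_chain.induct)
  case (refl a) show ?case by (rule C1_chain.refl)
next
  case (step a b c)
  have "C1_chain (\<lambda>t. \<gamma> (- t)) (- b) (- a)"
    using C1_curve_affine[of a b \<gamma> "- b" "- a" "-1" 0] step by (intro C1_chain_single) auto
  then show ?case using step C1_chain_trans by blast
qed

text \<open>
  The speed with two-sided derivatives. In contrast to the integrand of \<^const>\<open>curve_length\<close> it does
  not depend on the parameter interval, so that lengths of adjacent arcs add up.
\<close>

definition speed :: "(real \<Rightarrow> 'a) \<Rightarrow> real \<Rightarrow> real" where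
  "speed \<gamma> t = tnorm g (\<gamma> t) (velocity A UNIV \<gamma> t)"

lemma velocity_interior: "t \<in> {a<..<b} \<Longrightarrow> velocity A {a..b} \<gamma> t = velocity A UNIV \<gamma> t"
  by (auto simp: velocity_def at_within_Icc_at)

lemma curve_length_eq_integral_speed: "curve_length A g a b \<gamma> = integral {a..b} (speed \<gamma>)"
  unfolding curve_length_def
  by (rule integral_spike[of "{a,b}"]) (auto simp: speed_def velocity_interior)

lemma integral_speed_cong:
  assumes "\<And>t. t \<in> {a..b} \<Longrightarrow> \<delta> t = \<gamma> t"
  shows "integral {a..b} (speed \<delta>) = integral {a..b} (speed \<gamma>)"
proof -
  have "vector_derivative (F \<circ> \<delta>) (at t within {a..b}) = vector_derivative (F \<circ> \<gamma>) (at t within {a..b})"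
    if "t \<in> {a..b}" for t and F :: "'a \<Rightarrow> real^'n"
  proof -
    have "((F \<circ> \<delta>) has_vector_derivative D) (at t within {a..b}) \<longleftrightarrow>
        ((F \<circ> \<gamma>) has_vector_derivative D) (at t within {a..b})" for D
      using has_vector_derivative_transform[OF that, of "F \<circ> \<delta>" "F \<circ> \<gamma>" D]
        has_vector_derivative_transform[OF that, of "F \<circ> \<gamma>" "F \<circ> \<delta>" D] assms
      by auto
    then show ?thesis by (simp add: vector_derivative_def)
  qed
  then have "velocity A {a..b} \<delta> t = velocity A {a..b} \<gamma> t" if "t \<in> {a..b}" for t
    using that assms[OF that] by (auto simp: velocity_def)
  then show ?thesis
    unfolding curve_length_eq_integral_speed[symmetric] curve_length_def
    using assms by (intro integral_cong) simp
qed

definition regular :: "(real \<Rightarrow> 'a) \<Rightarrow> real \<Rightarrow> bool" where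
  "regular \<gamma> t \<longleftrightarrow> isCont \<gamma> t \<and> (\<forall>c\<in>A. \<gamma> t \<in> chart_dom c \<longrightarrow> (chart_map c \<circ> \<gamma>) differentiable (at t))"

text \<open>Velocities transform like tangent vectors, by the chain rule for the transition maps.\<close>

lemma velocity_in_tangent_space:
  assumes nbot: "at t within I \<noteq> bot" and cont: "continuous (at t within I) \<gamma>"
    and diff: "\<And>c. c \<in> A \<Longrightarrow> \<gamma> t \<in> chart_dom c \<Longrightarrow> (chart_map c \<circ> \<gamma>) differentiable (at t within I)"
    and t: "t \<in> I"
  shows "velocity A I \<gamma> t \<in> tangent_space A (\<gamma> t)"
proof -
  have "velocity A I \<gamma> t c' = transition_deriv c c' (\<gamma> t) (velocity A I \<gamma> t c)"
    if c: "c \<in> A" "\<gamma> t \<in> chart_dom c" and c': "c' \<in> A" "\<gamma> t \<in> chart_dom c'" for c c'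
  proof -
    have vd: "((chart_map e \<circ> \<gamma>) has_vector_derivative velocity A I \<gamma> t e) (at t within I)"
      if "e \<in> A" "\<gamma> t \<in> chart_dom e" for e
      using diff[OF that] that by (simp add: velocity_def vector_derivative_works)
    have "((chart_map c' \<circ> chart_inv c) has_derivative transition_deriv c c' (\<gamma> t))
        (at ((chart_map c \<circ> \<gamma>) t) within (chart_map c \<circ> \<gamma>) ` I)"
      using has_derivative_at_withinI[OF transition_has_derivative[OF c(1) c'(1) c(2) c'(2)]] by simp
    from vector_derivative_diff_chain_within[OF vd[OF c] this]
    have 1: "(((chart_map c' \<circ> chart_inv c) \<circ> (chart_map c \<circ> \<gamma>)) has_vector_derivative
        transition_deriv c c' (\<gamma> t) (velocity A I \<gamma> t c)) (at t within I)" .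
    have "\<forall>\<^sub>F s in at t within I. \<gamma> s \<in> chart_dom c"
      using topological_tendstoD[OF cont[unfolded continuous_within] chart_open(1)[OF c(1)] c(2)] .
    then have "\<forall>\<^sub>F s in at t within I.
        ((chart_map c' \<circ> chart_inv c) \<circ> (chart_map c \<circ> \<gamma>)) s = (chart_map c' \<circ> \<gamma>) s"
      by eventually_elim (use c in simp)
    then have "((chart_map c' \<circ> \<gamma>) has_vector_derivative
        transition_deriv c c' (\<gamma> t) (velocity A I \<gamma> t c)) (at t within I)"
      using 1 c t unfolding has_vector_derivative_def
      by (intro has_derivative_transform_eventually[OF 1[unfolded has_vector_derivative_def]]) auto
    from vector_derivative_unique_within[OF nbot vd[OF c'] this] show ?thesis .
  qed
  note transform = this
  show ?thesis
    unfolding tangent_space_def mem_Collect_eq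
  proof (intro conjI ballI allI impI)
    fix c c' assume "c \<in> A" "c' \<in> A" "\<gamma> t \<in> chart_dom c \<inter> chart_dom c'"
    then show "velocity A I \<gamma> t c' = transition_deriv c c' (\<gamma> t) (velocity A I \<gamma> t c)"
      using transform by blast
  qed (auto simp: velocity_def)
qed

lemma regular_velocity_in_tangent_space:
  "regular \<gamma> t \<Longrightarrow> velocity A UNIV \<gamma> t \<in> tangent_space A (\<gamma> t)"
  by (rule velocity_in_tangent_space) (auto simp: regular_def)

lemma regular_speed_nonneg: "regular \<gamma> t \<Longrightarrow> speed \<gamma> t \<ge> 0"
  unfolding speed_def by (intro tnorm_nonneg regular_velocity_in_tangent_space)

lemma regular_has_vector_derivative:
  assumes "regular \<gamma> t" "c \<in> A" "\<gamma> t \<in> chart_dom c"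
  shows "((chart_map c \<circ> \<gamma>) has_vector_derivative velocity A UNIV \<gamma> t c) (at t)"
  using assms by (simp add: regular_def velocity_def vector_derivative_works)

lemma C1_curve_regular:
  assumes "C1_curve A {a..b} \<gamma>" "t \<in> {a<..<b}"
  shows "regular \<gamma> t"
proof -
  have "(chart_map c \<circ> \<gamma>) differentiable (at t)" if "c \<in> A" "\<gamma> t \<in> chart_dom c" for c
  proof -
    have "((chart_map c \<circ> \<gamma>) has_vector_derivative velocity A {a..b} \<gamma> t c) (at t within {a..b})"
      by (rule C1_curve_has_vector_derivative[OF assms(1) that(1) _ that(2)]) (use assms(2) in auto)
    then show ?thesis
      using assms(2) by (simp add: at_within_Icc_at differentiableI_vector)
  qed
  moreover have "isCont \<gamma> t"
    using C1_curve_continuous[OF assms(1)] assms(2) continuous_on_interior[of "{a..b}"] by auto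
  ultimately show ?thesis by (simp add: regular_def)
qed

lemma C1_curve_speed_continuous:
  assumes C1: "C1_curve A {a..b} \<gamma>" and "a < b"
  shows "continuous_on {a..b} (\<lambda>t. tnorm g (\<gamma> t) (velocity A {a..b} \<gamma> t))"
  unfolding continuous_on_eq_continuous_within
proof
  let ?v = "velocity A {a..b} \<gamma>"
  have tan: "?v t \<in> tangent_space A (\<gamma> t)" if t: "t \<in> {a..b}" for t
  proof (rule velocity_in_tangent_space)
    show "at t within {a..b} \<noteq> bot"
      using islimpt_Icc[OF \<open>a < b\<close>, of t] t by (simp add: trivial_limit_within)
    show "continuous (at t within {a..b}) \<gamma>"
      using C1_curve_continuous[OF C1] t by (simp add: continuous_on_eq_continuous_within)
    show "(chart_map c \<circ> \<gamma>) differentiable (at t within {a..b})" if "c \<in> A" "\<gamma> t \<in> chart_dom c" for c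
      by (rule differentiableI_vector[OF C1_curve_has_vector_derivative[OF C1 that(1) t that(2)]])
  qed fact
  fix t assume t: "t \<in> {a..b}"
  obtain c where c: "c \<in> A" "\<gamma> t \<in> chart_dom c" by (rule chart_around)
  let ?J = "{t\<in>{a..b}. \<gamma> t \<in> chart_dom c}"
  have "continuous_on ?J (\<lambda>t. coord_metric c (\<gamma> t) (?v t c) (?v t c))"
    by (intro continuous_on_coord_metric[OF c(1)] C1_curve_velocity_continuous[OF C1 c(1)]
          continuous_on_subset[OF C1_curve_continuous[OF C1]]) auto
  then have "continuous_on ?J (\<lambda>t. sqrt (coord_metric c (\<gamma> t) (?v t c) (?v t c)))"
    by (intro continuous_intros)
  then have "continuous_on ?J (\<lambda>t. tnorm g (\<gamma> t) (?v t))"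
    by (rule continuous_on_eq) (use tan c in \<open>auto simp: tnorm_def metric_eq_coord_metric\<close>)
  then have "continuous (at t within ?J) (\<lambda>t. tnorm g (\<gamma> t) (?v t))"
    using t c by (simp add: continuous_on_eq_continuous_within)
  moreover obtain T where T: "open T" "?J = T \<inter> {a..b}"
  proof -
    have "openin (top_of_set {a..b}) ({a..b} \<inter> \<gamma> -` chart_dom c)"
      by (rule continuous_openin_preimage_gen[OF C1_curve_continuous[OF C1] chart_open(1)[OF c(1)]])
    then obtain T where "open T" and T: "{a..b} \<inter> \<gamma> -` chart_dom c = {a..b} \<inter> T"
      unfolding openin_open by blast
    have "?J = T \<inter> {a..b}" using T by blast
    with \<open>open T\<close> show ?thesis by (rule that)
  qed
  moreover have "at t within ?J = at t within {a..b}"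
    by (rule at_within_nhd[of t T]) (use T t c in auto)
  ultimately show "continuous (at t within {a..b}) (\<lambda>t. tnorm g (\<gamma> t) (?v t))" by simp
qed

lemma C1_curve_speed_integrable:
  assumes "C1_curve A {a..b} \<gamma>" "a < b"
  shows "speed \<gamma> integrable_on {a..b}"
proof (rule integrable_spike_finite)
  show "(\<lambda>t. tnorm g (\<gamma> t) (velocity A {a..b} \<gamma> t)) integrable_on {a..b}"
    by (rule integrable_continuous_real[OF C1_curve_speed_continuous[OF assms]])
  show "finite {a, b}" by simp
  show "speed \<gamma> t = tnorm g (\<gamma> t) (velocity A {a..b} \<gamma> t)" if "t \<in> {a..b} - {a, b}" for t
    using that by (simp add: speed_def velocity_interior)
qed

lemma C1_chain_continuous: "C1_chain \<gamma> a b \<Longrightarrow> continuous_on {a..b} \<gamma>"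
proof (induction rule: C1_chain.induct)
  case (step a b c)
  have "{a..b} \<union> {b..c} = {a..c}"
    using step(1) C1_chain_le[OF step(3)] by (intro ivl_disj_un_two_touch) auto
  then show ?case
    using continuous_on_closed_Un[of "{a..b}" "{b..c}" \<gamma>] step C1_curve_continuous[OF step(2)] by simp
qed auto

lemma C1_chain_speed_integrable: "C1_chain \<gamma> a b \<Longrightarrow> speed \<gamma> integrable_on {a..b}"
proof (induction rule: C1_chain.induct)
  case (refl a) show ?case using integrable_on_refl[of "speed \<gamma>" a] by (simp only: box_real)
next
  case (step a b c)
  then show ?case
    using Henstock_Kurzweil_Integration.integrable_combine[of a b c "speed \<gamma>"]
      C1_curve_speed_integrable[OF step(2,1)] C1_chain_le[OF step(3)] by simp
qed

lemma C1_chain_regular: "C1_chain \<gamma> a b \<Longrightarrow> \<exists>S. finite S \<and> (\<forall>t\<in>{a..b} - S. regular \<gamma> t)"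
proof (induction rule: C1_chain.induct)
  case (refl a) show ?case by (intro exI[of _ "{a}"]) auto
next
  case (step a b c)
  then obtain S where "finite S" "\<forall>t\<in>{b..c} - S. regular \<gamma> t" by blast
  have "regular \<gamma> t" if "t \<in> {a..c} - ({a,b} \<union> S)" for t
  proof (cases "t < b")
    case True
    then show ?thesis using that by (intro C1_curve_regular[OF step(2)]) simp
  next
    case False
    then show ?thesis using that \<open>\<forall>t\<in>{b..c} - S. regular \<gamma> t\<close> by simp
  qed
  then show ?case using \<open>finite S\<close> by (intro exI[of _ "{a,b} \<union> S"]) auto
qed

lemma C1_chain_length_combine:
  assumes "C1_chain \<gamma> a b" "C1_chain \<gamma> b c"
  shows "integral {a..b} (speed \<gamma>) + integral {b..c} (speed \<gamma>) = integral {a..c} (speed \<gamma>)"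
  using C1_chain_le[OF assms(1)] C1_chain_le[OF assms(2)]
    C1_chain_speed_integrable[OF C1_chain_trans[OF assms]]
  by (rule Henstock_Kurzweil_Integration.integral_combine)

lemma C1_chain_length_nonneg:
  assumes "C1_chain \<gamma> a b"
  shows "integral {a..b} (speed \<gamma>) \<ge> 0"
proof -
  obtain S where S: "finite S" "\<And>t. t \<in> {a..b} - S \<Longrightarrow> regular \<gamma> t"
    using C1_chain_regular[OF assms] by blast
  have "((\<lambda>t. if t \<in> S then 0 else speed \<gamma> t) has_integral integral {a..b} (speed \<gamma>)) {a..b}"
    by (rule has_integral_spike_finite[OF S(1) _ integrable_integral[OF C1_chain_speed_integrable[OF assms]]])
       simp
  then show ?thesis
    by (rule has_integral_nonneg) (use S regular_speed_nonneg in auto)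
qed

lemma speed_affine:
  assumes "regular \<gamma> (k * t + s)" "k = 1 \<or> k = -1"
  shows "speed (\<lambda>t. \<gamma> (k * t + s)) t = speed \<gamma> (k * t + s)"
proof -
  let ?p = "\<gamma> (k * t + s)" and ?v = "velocity A UNIV \<gamma> (k * t + s)"
  note tan = regular_velocity_in_tangent_space[OF assms(1)]
  have "velocity A UNIV (\<lambda>t. \<gamma> (k * t + s)) t = (\<lambda>c. k *\<^sub>R ?v c + 0 *\<^sub>R ?v c)"
  proof
    fix c
    show "velocity A UNIV (\<lambda>t. \<gamma> (k * t + s)) t c = k *\<^sub>R ?v c + 0 *\<^sub>R ?v c"
    proof (cases "c \<in> A \<and> ?p \<in> chart_dom c")
      case True
      have "((\<lambda>t. k * t + s) has_vector_derivative k) (at t)"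
        by (auto intro!: derivative_eq_intros)
      from vector_diff_chain_at[OF this, of "chart_map c \<circ> \<gamma>" "?v c"]
      have "((chart_map c \<circ> (\<lambda>t. \<gamma> (k * t + s))) has_vector_derivative k *\<^sub>R ?v c) (at t)"
        using regular_has_vector_derivative[OF assms(1)] True by (simp add: comp_def)
      then show ?thesis using True by (simp add: velocity_def vector_derivative_at)
    qed (auto simp: velocity_def)
  qed
  moreover have "g ?p (\<lambda>c. k *\<^sub>R ?v c + 0 *\<^sub>R ?v c) (\<lambda>c. k *\<^sub>R ?v c + 0 *\<^sub>R ?v c) = k * k * g ?p ?v ?v"
    using metric_linear[OF tan tan tan, of k 0] metric_sym[OF tan tangent_space_lincomb[OF tan tan], of k 0]
      metric_linear[OF tan tan tangent_space_lincomb[OF tan tan, of k 0], of k 0]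
    by simp
  moreover have "k * k = 1" using assms(2) by auto
  ultimately show ?thesis by (simp add: speed_def tnorm_def)
qed

lemma C1_chain_length_shift:
  assumes "C1_chain \<gamma> a b"
  shows "integral {a - s..b - s} (speed (\<lambda>t. \<gamma> (t + s))) = integral {a..b} (speed \<gamma>)"
proof -
  obtain S where S: "finite S" "\<And>t. t \<in> {a..b} - S \<Longrightarrow> regular \<gamma> t"
    using C1_chain_regular[OF assms] by blast
  have "integral {a - s..b - s} (\<lambda>t. speed \<gamma> (t + s)) = integral {a - s..b - s} (speed (\<lambda>t. \<gamma> (t + s)))"
  proof (rule integral_spike)
    show "negligible ((\<lambda>t. t - s) ` S)" using S(1) by (intro negligible_finite finite_imageI)
    fix t assume t: "t \<in> {a - s..b - s} - (\<lambda>t. t - s) ` S"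
    then have "t + s \<notin> S" using image_eqI[of t "\<lambda>t. t - s" "t + s" S] by auto
    then have "regular \<gamma> (t + s)" using t by (intro S(2)) auto
    then show "speed (\<lambda>t. \<gamma> (t + s)) t = speed \<gamma> (t + s)"
      using speed_affine[of \<gamma> 1 t s] by simp
  qed
  then show ?thesis by (simp add: integral_shift_real_ivl)
qed

lemma C1_chain_length_reverse:
  assumes "C1_chain \<gamma> a b"
  shows "integral {- b..- a} (speed (\<lambda>t. \<gamma> (- t))) = integral {a..b} (speed \<gamma>)"
proof -
  obtain S where S: "finite S" "\<And>t. t \<in> {a..b} - S \<Longrightarrow> regular \<gamma> t"
    using C1_chain_regular[OF assms] by blast
  have "integral {- b..- a} (\<lambda>t. speed \<gamma> (- t)) = integral {- b..- a} (speed (\<lambda>t. \<gamma> (- t)))"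
  proof (rule integral_spike)
    show "negligible (uminus ` S)" using S(1) by (intro negligible_finite finite_imageI)
    fix t assume t: "t \<in> {- b..- a} - uminus ` S"
    then have "- t \<notin> S" using image_eqI[of t uminus "- t" S] by auto
    then have "regular \<gamma> (- t)" using t by (intro S(2)) auto
    then show "speed (\<lambda>t. \<gamma> (- t)) t = speed \<gamma> (- t)"
      using speed_affine[of \<gamma> "-1" t 0] by simp
  qed
  then show ?thesis
    using Henstock_Kurzweil_Integration.integral_reflect_real[of b a "speed \<gamma>"] by simp
qed

text \<open>
  The coordinate displacement is the integral of the coordinate velocity, whose norm is at most the speed
  divided by \<open>m\<close>.
\<close>

lemma C1_chain_displacement_le:
  assumes chain: "C1_chain \<gamma> a b" and c: "c \<in> A" and "m > 0"
    and inside: "\<And>t. t \<in> {a..b} \<Longrightarrow> \<gamma> t \<in> chart_dom c"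
    and bound: "\<And>t v. t \<in> {a..b} \<Longrightarrow> v \<in> tangent_space A (\<gamma> t) \<Longrightarrow> m * norm (v c) \<le> tnorm g (\<gamma> t) v"
  shows "m * norm (chart_map c (\<gamma> b) - chart_map c (\<gamma> a)) \<le> integral {a..b} (speed \<gamma>)"
proof -
  obtain S where S: "finite S" "\<And>t. t \<in> {a..b} - S \<Longrightarrow> regular \<gamma> t"
    using C1_chain_regular[OF chain] by blast
  let ?f = "chart_map c \<circ> \<gamma>"
  let ?v = "\<lambda>t. if t \<in> S then 0 else velocity A UNIV \<gamma> t c"
  have "continuous_on {a..b} ?f"
    by (intro continuous_on_compose[OF C1_chain_continuous[OF chain]]
          continuous_on_subset[OF continuous_on_chart[OF c]]) (use inside in auto)
  have f: "(?v has_integral (?f b - ?f a)) {a..b}"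
  proof (rule fundamental_theorem_of_calculus_interior_strong[OF S(1) C1_chain_le[OF chain]])
    fix t assume t: "t \<in> {a<..<b} - S"
    then have "(?f has_vector_derivative velocity A UNIV \<gamma> t c) (at t)"
      by (intro regular_has_vector_derivative[OF _ c] S(2) inside) auto
    then show "(?f has_vector_derivative ?v t) (at t)" using t by simp
  qed fact
  have h: "((\<lambda>t. if t \<in> S then 0 else speed \<gamma> t) has_integral integral {a..b} (speed \<gamma>)) {a..b}"
    by (rule has_integral_spike_finite[OF S(1) _ integrable_integral[OF C1_chain_speed_integrable[OF chain]]])
       simp
  have "norm (integral {a..b} (\<lambda>t. m *\<^sub>R ?v t)) \<le> integral {a..b} (\<lambda>t. if t \<in> S then 0 else speed \<gamma> t)"
  proof (rule Henstock_Kurzweil_Integration.integral_norm_bound_integral)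
    show "(\<lambda>t. m *\<^sub>R ?v t) integrable_on {a..b}"
      by (rule has_integral_integrable[OF has_integral_cmul[OF f]])
    show "(\<lambda>t. if t \<in> S then 0 else speed \<gamma> t) integrable_on {a..b}"
      by (rule has_integral_integrable[OF h])
    show "norm (m *\<^sub>R ?v t) \<le> (if t \<in> S then 0 else speed \<gamma> t)" if "t \<in> {a..b}" for t
    proof (cases "t \<in> S")
      case False
      then have "velocity A UNIV \<gamma> t \<in> tangent_space A (\<gamma> t)"
        using that by (intro regular_velocity_in_tangent_space S(2)) simp
      from bound[OF that this] False \<open>m > 0\<close> show ?thesis by (simp add: speed_def)
    qed simp
  qed
  then show ?thesis
    using integral_unique[OF has_integral_cmul[OF f, of m]] integral_unique[OF h] \<open>m > 0\<close>
    by (simp add: comp_def flip: scaleR_diff_right)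
qed

lemma chart_segment_C1_curve:
  assumes c: "c \<in> A" and seg: "closed_segment y z \<subseteq> chart_img c"
  defines "\<gamma> \<equiv> \<lambda>t. chart_inv c (y + t *\<^sub>R (z - y))"
  shows "C1_curve A {0..1} \<gamma>"
    and "\<And>t. t \<in> {0<..<1} \<Longrightarrow> velocity A UNIV \<gamma> t c = z - y"
proof -
  let ?l = "\<lambda>t. y + t *\<^sub>R (z - y)"
  have l: "?l t \<in> chart_img c" if "t \<in> {0..1}" for t
  proof -
    have "?l t = (1 - t) *\<^sub>R y + t *\<^sub>R z" by (simp add: algebra_simps)
    then show ?thesis using that seg by (auto simp: closed_segment_def)
  qed
  have dl: "(?l has_vector_derivative z - y) (at t within I)" for t I
    by (auto intro!: derivative_eq_intros)
  have vd: "((chart_map c' \<circ> \<gamma>) has_vector_derivative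
      frechet_derivative (chart_map c' \<circ> chart_inv c) (at (?l t)) (z - y)) (at t within {0..1})"
    if c': "c' \<in> A" and t: "t \<in> {0..1}" "\<gamma> t \<in> chart_dom c'" for c' t
  proof -
    have "((chart_map c' \<circ> chart_inv c) has_derivative transition_deriv c c' (\<gamma> t)) (at (?l t))"
      using transition_has_derivative[OF c c', of "\<gamma> t"] t l c by (simp add: \<gamma>_def)
    moreover have "transition_deriv c c' (\<gamma> t) =
        frechet_derivative (chart_map c' \<circ> chart_inv c) (at (?l t))"
      using l[OF t(1)] c by (simp add: transition_deriv_def \<gamma>_def)
    ultimately have "((chart_map c' \<circ> chart_inv c) has_derivative
        frechet_derivative (chart_map c' \<circ> chart_inv c) (at (?l t))) (at (?l t) within ?l ` {0..1})"
      using has_derivative_at_withinI by auto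
    from vector_derivative_diff_chain_within[OF dl this]
    show ?thesis by (simp add: \<gamma>_def comp_def)
  qed
  show C1: "C1_curve A {0..1} \<gamma>"
  proof (rule C1_curveI)
    show "continuous_on {0..1} \<gamma>" unfolding \<gamma>_def
      by (rule continuous_on_compose2[OF continuous_on_chart_inv[OF c]])
         (use l in \<open>auto intro!: continuous_intros\<close>)
    fix c' assume c': "c' \<in> A"
    have "Ck_on 1 (chart_map c ` (chart_dom c \<inter> chart_dom c')) (chart_map c' \<circ> chart_inv c)"
      using atlas c c' unfolding smooth_atlas_def smooth_on_def by blast
    then have "continuous_on (chart_map c ` (chart_dom c \<inter> chart_dom c'))
        (\<lambda>x. frechet_derivative (chart_map c' \<circ> chart_inv c) (at x) (z - y))"
      by simp
    then have "continuous_on {t\<in>{0..1}. \<gamma> t \<in> chart_dom c'}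
        (\<lambda>t. frechet_derivative (chart_map c' \<circ> chart_inv c) (at (?l t)) (z - y))"
    proof (rule continuous_on_compose2[where f = ?l])
      show "?l ` {t\<in>{0..1}. \<gamma> t \<in> chart_dom c'} \<subseteq> chart_map c ` (chart_dom c \<inter> chart_dom c')"
      proof
        fix w assume "w \<in> ?l ` {t\<in>{0..1}. \<gamma> t \<in> chart_dom c'}"
        then obtain t where t: "t \<in> {0..1}" "\<gamma> t \<in> chart_dom c'" "w = ?l t" by auto
        then have "w = chart_map c (\<gamma> t)" "\<gamma> t \<in> chart_dom c"
          using l[OF t(1)] c by (auto simp: \<gamma>_def)
        then show "w \<in> chart_map c ` (chart_dom c \<inter> chart_dom c')" using t by blast
      qed
    qed (intro continuous_intros)
    then show "\<exists>D. (\<forall>t\<in>{0..1}. \<gamma> t \<in> chart_dom c' \<longrightarrow>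
            ((chart_map c' \<circ> \<gamma>) has_vector_derivative D t) (at t within {0..1})) \<and>
          continuous_on {t\<in>{0..1}. \<gamma> t \<in> chart_dom c'} D"
      using vd[OF c']
      by (intro exI[of _ "\<lambda>t. frechet_derivative (chart_map c' \<circ> chart_inv c) (at (?l t)) (z - y)"]) simp
  qed simp
  show "velocity A UNIV \<gamma> t c = z - y" if "t \<in> {0<..<1}" for t
  proof -
    have t: "t \<in> {0..1}" and \<gamma>t: "\<gamma> t \<in> chart_dom c" using that l c by (auto simp: \<gamma>_def)
    have "((chart_map c \<circ> \<gamma>) has_vector_derivative z - y) (at t within {0..1})"
      by (rule has_vector_derivative_transform[OF t _ dl]) (use l c in \<open>auto simp: \<gamma>_def\<close>)
    then have "((chart_map c \<circ> \<gamma>) has_vector_derivative z - y) (at t)"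
      using that by (simp add: at_within_Icc_at)
    then show ?thesis using c \<gamma>t by (simp add: velocity_def vector_derivative_at)
  qed
qed

end

section \<open>The Riemannian distance\<close>

context riemannian
begin

definition reach :: "'a \<Rightarrow> 'a \<Rightarrow> real \<Rightarrow> bool" where
  "reach x y l \<longleftrightarrow> (\<exists>a b \<gamma>. C1_chain \<gamma> a b \<and> \<gamma> a = x \<and> \<gamma> b = y \<and> integral {a..b} (speed \<gamma>) = l)"

lemma reachI: "C1_chain \<gamma> a b \<Longrightarrow> reach (\<gamma> a) (\<gamma> b) (integral {a..b} (speed \<gamma>))"
  unfolding reach_def by blast

lemma rdist_eq_Inf_reach: "rdist A g x y = Inf {l. reach x y l}"
  unfolding rdist_def reach_def piecewise_C1_curve_iff_C1_chain curve_length_eq_integral_speed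
  by (rule arg_cong[where f = Inf]) blast

lemma reach_nonneg: "reach x y l \<Longrightarrow> l \<ge> 0"
  unfolding reach_def using C1_chain_length_nonneg by blast

lemma reach_refl: "reach x x 0"
  using reachI[OF C1_chain.refl, of "\<lambda>_. x" 0] by simp

lemma reach_sym:
  assumes "reach x y l"
  shows "reach y x l"
proof -
  obtain a b \<gamma> where \<gamma>: "C1_chain \<gamma> a b" "\<gamma> a = x" "\<gamma> b = y" "integral {a..b} (speed \<gamma>) = l"
    using assms unfolding reach_def by blast
  show ?thesis
    using reachI[OF C1_chain_reverse[OF \<gamma>(1)]] C1_chain_length_reverse[OF \<gamma>(1)] \<gamma>(2-4) by simp
qed

lemma reach_trans:
  assumes "reach x y l" "reach y z m"
  shows "reach x z (l + m)"
proof -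
  obtain a b \<gamma> where \<gamma>: "C1_chain \<gamma> a b" "\<gamma> a = x" "\<gamma> b = y" "integral {a..b} (speed \<gamma>) = l"
    using assms(1) unfolding reach_def by blast
  obtain a' b' \<delta> where \<delta>: "C1_chain \<delta> a' b'" "\<delta> a' = y" "\<delta> b' = z" "integral {a'..b'} (speed \<delta>) = m"
    using assms(2) unfolding reach_def by blast
  \<comment> \<open>The second curve is shifted in time to start when the first one ends.\<close>
  define s where "s = a' - b"
  define e where "e = b' - s"
  have \<delta>': "C1_chain (\<lambda>t. \<delta> (t + s)) b e" "integral {b..e} (speed (\<lambda>t. \<delta> (t + s))) = m"
    using C1_chain_shift[OF \<delta>(1), of s] C1_chain_length_shift[OF \<delta>(1), of s] \<delta>(4)
    by (simp_all add: s_def e_def)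
  define \<beta> where "\<beta> t = (if t \<le> b then \<gamma> t else \<delta> (t + s))" for t
  have left: "\<beta> t = \<gamma> t" if "t \<in> {a..b}" for t using that by (simp add: \<beta>_def)
  have right: "\<beta> t = \<delta> (t + s)" if "t \<in> {b..e}" for t
    using that \<gamma>(3) \<delta>(2) by (auto simp: \<beta>_def s_def)
  have ab: "C1_chain \<beta> a b" by (rule C1_chain_cong[OF \<gamma>(1) left])
  have be: "C1_chain \<beta> b e" by (rule C1_chain_cong[OF \<delta>'(1) right])
  have "integral {a..e} (speed \<beta>) = integral {a..b} (speed \<beta>) + integral {b..e} (speed \<beta>)"
    using C1_chain_length_combine[OF ab be] by simp
  also have "integral {a..b} (speed \<beta>) = l" using integral_speed_cong[OF left] \<gamma>(4) by simp
  also have "integral {b..e} (speed \<beta>) = m" using integral_speed_cong[OF right] \<delta>'(2) by simp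
  finally have len: "integral {a..e} (speed \<beta>) = l + m" .
  have "\<beta> a = x" using left[of a] C1_chain_le[OF ab] \<gamma>(2) by simp
  moreover have "\<beta> e = z" using right[of e] C1_chain_le[OF be] \<delta>(3) by (simp add: e_def)
  ultimately show ?thesis using reachI[OF C1_chain_trans[OF ab be]] len by simp
qed

text \<open>Arc length depends continuously on the parameter, so a curve can be cut at any length.\<close>

lemma reach_split:
  assumes "reach x y l" "0 \<le> u" "u \<le> l"
  shows "\<exists>z. reach x z u \<and> reach z y (l - u)"
proof -
  obtain a b \<gamma> where \<gamma>: "C1_chain \<gamma> a b" "\<gamma> a = x" "\<gamma> b = y" "integral {a..b} (speed \<gamma>) = l"
    using assms(1) unfolding reach_def by blast
  have "continuous_on {a..b} (\<lambda>t. integral {a..t} (speed \<gamma>))"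
    by (rule indefinite_integral_continuous_1[OF C1_chain_speed_integrable[OF \<gamma>(1)]])
  then obtain t where t: "a \<le> t" "t \<le> b" "integral {a..t} (speed \<gamma>) = u"
    using IVT'[of "\<lambda>t. integral {a..t} (speed \<gamma>)" a u b] C1_chain_le[OF \<gamma>(1)] \<gamma>(4) assms(2,3)
    by auto
  then have s: "C1_chain \<gamma> a t" "C1_chain \<gamma> t b"
    using C1_chain_split[OF \<gamma>(1), of t] by auto
  have "integral {t..b} (speed \<gamma>) = l - u"
    using C1_chain_length_combine[OF s] t(3) \<gamma>(4) by simp
  then show ?thesis using reachI[OF s(1)] reachI[OF s(2)] t(3) \<gamma>(2,3) by auto
qed

lemma reach_segment:
  assumes c: "c \<in> A" and pq: "p \<in> chart_dom c" "q \<in> chart_dom c"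
    and seg: "closed_segment (chart_map c p) (chart_map c q) \<subseteq> chart_img c"
    and bound: "\<And>p' v. p' \<in> chart_dom c \<Longrightarrow>
        chart_map c p' \<in> closed_segment (chart_map c p) (chart_map c q) \<Longrightarrow>
        v \<in> tangent_space A p' \<Longrightarrow> tnorm g p' v \<le> M * norm (v c)"
  shows "\<exists>l. reach p q l \<and> l \<le> M * norm (chart_map c q - chart_map c p)"
proof -
  let ?y = "chart_map c p" and ?z = "chart_map c q"
  define \<gamma> where "\<gamma> t = chart_inv c (?y + t *\<^sub>R (?z - ?y))" for t :: real
  note C1 = chart_segment_C1_curve[OF c seg, folded \<gamma>_def]
  have chain: "C1_chain \<gamma> 0 1" by (rule C1_chain_single[OF _ C1(1)]) simp
  have le: "speed \<gamma> t \<le> M * norm (?z - ?y)" if t: "t \<in> {0<..<1}" for t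
  proof -
    have on: "?y + t *\<^sub>R (?z - ?y) \<in> closed_segment ?y ?z"
      using t by (auto simp: closed_segment_def algebra_simps intro!: exI[of _ t])
    then have "?y + t *\<^sub>R (?z - ?y) \<in> chart_img c" using seg by blast
    then have "\<gamma> t \<in> chart_dom c" "chart_map c (\<gamma> t) = ?y + t *\<^sub>R (?z - ?y)"
      using c by (simp_all add: \<gamma>_def)
    with on have "speed \<gamma> t \<le> M * norm (velocity A UNIV \<gamma> t c)"
      unfolding speed_def
      by (intro bound regular_velocity_in_tangent_space C1_curve_regular[OF C1(1) t]) simp_all
    then show ?thesis using C1(2)[OF t] by simp
  qed
  have "integral {0..1} (speed \<gamma>) \<le> integral {0..1} (\<lambda>t::real. M * norm (?z - ?y))"
  proof -
    have h: "((\<lambda>t. if t \<in> {0,1} then M * norm (?z - ?y) else speed \<gamma> t) has_integral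
        integral {0..1} (speed \<gamma>)) {0..1}"
      by (rule has_integral_spike_finite[of "{0,1}",
            OF _ _ integrable_integral[OF C1_chain_speed_integrable[OF chain]]]) auto
    show ?thesis
    proof (rule has_integral_le[OF h integrable_integral])
      show "(\<lambda>t::real. M * norm (?z - ?y)) integrable_on {0..1}" by (rule integrable_const_ivl)
      show "(if t \<in> {0,1} then M * norm (?z - ?y) else speed \<gamma> t) \<le> M * norm (?z - ?y)"
        if "t \<in> {0..1}" for t
        using le[of t] that by auto
    qed
  qed
  moreover have "\<gamma> 0 = p" "\<gamma> 1 = q" using c pq by (simp_all add: \<gamma>_def)
  ultimately show ?thesis using reachI[OF chain] by auto
qed

lemma open_chart_vimage:
  assumes "c \<in> A" "open W"
  shows "open {q \<in> chart_dom c. chart_map c q \<in> W}"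
proof -
  have "openin (top_of_set (chart_dom c)) (chart_dom c \<inter> chart_map c -` W)"
    by (rule continuous_openin_preimage_gen[OF continuous_on_chart[OF assms(1)] assms(2)])
  moreover have "chart_dom c \<inter> chart_map c -` W = {q \<in> chart_dom c. chart_map c q \<in> W}" by auto
  ultimately show ?thesis using chart_open(1)[OF assms(1)] openin_open_trans by metis
qed

text \<open>
  Up to the first exit from the coordinate ball, the length of a curve that starts at the centre is at least
  \<open>m\<close> times the coordinate displacement, which is \<open>r\<close> at the exit. So a curve shorter than \<open>m * r\<close> has no
  exit, and the same estimate applies to all of it.
\<close>

lemma reach_short_stays:
  assumes c: "c \<in> A" and p: "p \<in> chart_dom c" and "m > 0" "r > 0"
    and ball: "cball (chart_map c p) r \<subseteq> chart_img c"
    and bound: "\<And>p' v. p' \<in> chart_dom c \<Longrightarrow> chart_map c p' \<in> cball (chart_map c p) r \<Longrightarrow>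
        v \<in> tangent_space A p' \<Longrightarrow> m * norm (v c) \<le> tnorm g p' v"
    and reach: "reach p q l" and short: "l < m * r"
  shows "q \<in> chart_dom c \<and> m * norm (chart_map c q - chart_map c p) \<le> l"
proof -
  let ?y = "chart_map c p"
  define V where "V = chart_inv c ` ball ?y r"
  define K where "K = chart_inv c ` cball ?y r"
  have KD: "x \<in> chart_dom c \<and> chart_map c x \<in> cball ?y r" if "x \<in> K" for x
    using that ball c by (auto simp: K_def)
  have "compact K"
    unfolding K_def
    by (rule compact_continuous_image[OF continuous_on_subset[OF continuous_on_chart_inv[OF c] ball] compact_cball])
  then have "closed K" by (rule compact_imp_closed)
  have V_eq: "V = {x \<in> chart_dom c. chart_map c x \<in> ball ?y r}"
  proof -
    have "x \<in> V" if "x \<in> chart_dom c" "chart_map c x \<in> ball ?y r" for x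
      unfolding V_def using image_eqI[OF _ that(2), of x "chart_inv c"] that c by simp
    moreover have "x \<in> chart_dom c \<and> chart_map c x \<in> ball ?y r" if "x \<in> V" for x
    proof -
      obtain w where w: "w \<in> ball ?y r" "x = chart_inv c w" using \<open>x \<in> V\<close> by (auto simp: V_def)
      then have "w \<in> chart_img c" using ball ball_subset_cball by blast
      then show ?thesis using w c by simp
    qed
    ultimately show ?thesis by blast
  qed
  have "open V" unfolding V_eq by (rule open_chart_vimage[OF c open_ball])
  have VK: "V \<subseteq> K" unfolding V_def K_def by auto
  obtain a b \<gamma> where \<gamma>: "C1_chain \<gamma> a b" "\<gamma> a = p" "\<gamma> b = q" "integral {a..b} (speed \<gamma>) = l"
    using reach unfolding reach_def by blast
  have "a \<le> b" using C1_chain_le[OF \<gamma>(1)] .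
  have disp: "m * norm (chart_map c (\<gamma> T) - ?y) \<le> l"
    if T: "T \<in> {a..b}" and in_K: "\<And>t. t \<in> {a..T} \<Longrightarrow> \<gamma> t \<in> K" for T
  proof -
    note s = C1_chain_split[OF \<gamma>(1) T]
    have "m * norm (chart_map c (\<gamma> T) - chart_map c (\<gamma> a)) \<le> integral {a..T} (speed \<gamma>)"
    proof (rule C1_chain_displacement_le[OF conjunct1[OF s] c \<open>m > 0\<close>])
      show "\<gamma> t \<in> chart_dom c" if "t \<in> {a..T}" for t using KD[OF in_K[OF that]] by blast
      show "m * norm (v c) \<le> tnorm g (\<gamma> t) v" if "t \<in> {a..T}" "v \<in> tangent_space A (\<gamma> t)" for t v
        using KD[OF in_K[OF that(1)]] by (intro bound that(2)) auto
    qed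
    also have "\<dots> \<le> l"
      using C1_chain_length_combine[OF conjunct1[OF s] conjunct2[OF s]] C1_chain_length_nonneg[OF conjunct2[OF s]]
        \<gamma>(4) by linarith
    finally show ?thesis using \<gamma>(2) by simp
  qed
  have "\<gamma> t \<in> V" if "t \<in> {a..b}" for t
  proof (rule ccontr)
    assume "\<gamma> t \<notin> V"
    define E where "E = {a..b} \<inter> \<gamma> -` (- V)"
    have "closedin (top_of_set {a..b}) E"
      unfolding E_def
      by (rule continuous_closedin_preimage[OF C1_chain_continuous[OF \<gamma>(1)]]) (use \<open>open V\<close> in auto)
    then have "closed E" using closedin_closed_trans closed_atLeastAtMost by blast
    have "t \<in> E" using that \<open>\<gamma> t \<notin> V\<close> by (simp add: E_def)
    have bdd: "bdd_below E" unfolding E_def by (intro bdd_belowI[of _ a]) auto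
    \<comment> \<open>\<open>E\<close> is the set of times outside the open ball, and \<open>T\<close> is the first exit time.\<close>
    define T where "T = Inf E"
    have "T \<in> E"
      unfolding T_def using \<open>t \<in> E\<close> bdd \<open>closed E\<close> by (intro closed_contains_Inf) auto
    then have T: "T \<in> {a..b}" "\<gamma> T \<notin> V" by (auto simp: E_def)
    have before: "\<gamma> s \<in> V" if "s \<in> {a..<T}" for s
    proof (rule ccontr)
      assume "\<gamma> s \<notin> V"
      then have "s \<in> E" using that T by (auto simp: E_def)
      then have "T \<le> s" unfolding T_def using bdd by (rule cInf_lower)
      then show False using that by simp
    qed
    have "p \<in> V" using p \<open>r > 0\<close> by (simp add: V_eq)
    then have "a < T" using T \<gamma>(2) by (cases "a = T") auto
    have "\<gamma> T \<in> K"
    proof -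
      have "continuous_on {a..T} \<gamma>"
        using continuous_on_subset[OF C1_chain_continuous[OF \<gamma>(1)]] T by auto
      then have "closedin (top_of_set {a..T}) ({a..T} \<inter> \<gamma> -` K)"
        using \<open>closed K\<close> by (rule continuous_closedin_preimage)
      then have "closed ({a..T} \<inter> \<gamma> -` K)" using closedin_closed_trans closed_atLeastAtMost by blast
      moreover have "{a..<T} \<subseteq> {a..T} \<inter> \<gamma> -` K" using subsetD[OF VK before] by auto
      ultimately have "closure {a..<T} \<subseteq> {a..T} \<inter> \<gamma> -` K" by (intro closure_minimal)
      moreover have "T \<in> closure {a..<T}" using \<open>a < T\<close> by simp
      ultimately show ?thesis by blast
    qed
    then have "\<gamma> s \<in> K" if "s \<in> {a..T}" for s
      using subsetD[OF VK before[of s]] that by (cases "s = T") auto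
    then have "m * norm (chart_map c (\<gamma> T) - ?y) \<le> l" by (rule disp[OF T(1)])
    moreover have "norm (chart_map c (\<gamma> T) - ?y) \<ge> r"
      using T(2) KD[OF \<open>\<gamma> T \<in> K\<close>] by (auto simp: V_eq dist_norm norm_minus_commute)
    then have "m * r \<le> m * norm (chart_map c (\<gamma> T) - ?y)"
      using \<open>m > 0\<close> by (intro mult_left_mono) auto
    ultimately show False using short by linarith
  qed
  then have inK: "\<gamma> t \<in> K" if "t \<in> {a..b}" for t using that VK by blast
  have "m * norm (chart_map c (\<gamma> b) - ?y) \<le> l"
    by (rule disp) (use \<open>a \<le> b\<close> inK in auto)
  then show ?thesis using KD[OF inK[of b]] \<gamma>(3) \<open>a \<le> b\<close> by simp
qed

lemma good_chart_ball:
  assumes "open W" "p \<in> W"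
  obtains c r m M where "c \<in> A" "p \<in> chart_dom c" "r > 0" "m > 0" "M > 0"
    "cball (chart_map c p) r \<subseteq> chart_img c" "chart_inv c ` cball (chart_map c p) r \<subseteq> W"
    "\<And>p' v. p' \<in> chart_dom c \<Longrightarrow> chart_map c p' \<in> cball (chart_map c p) r \<Longrightarrow>
       v \<in> tangent_space A p' \<Longrightarrow> m * norm (v c) \<le> tnorm g p' v \<and> tnorm g p' v \<le> M * norm (v c)"
proof -
  obtain c where c: "c \<in> A" "p \<in> chart_dom c" by (rule chart_around)
  have "open (chart_map c ` (chart_dom c \<inter> W))" by (rule open_chart_image[OF c(1) assms(1)])
  moreover have "chart_map c p \<in> chart_map c ` (chart_dom c \<inter> W)" using c assms by blast
  ultimately obtain r where r: "r > 0" "cball (chart_map c p) r \<subseteq> chart_map c ` (chart_dom c \<inter> W)"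
    using open_contains_cball by blast
  have sub: "cball (chart_map c p) r \<subseteq> chart_img c" using r(2) by (auto simp: chart_img_def)
  have "chart_inv c ` cball (chart_map c p) r \<subseteq> chart_inv c ` chart_map c ` (chart_dom c \<inter> W)"
    using r(2) by (rule image_mono)
  also have "\<dots> \<subseteq> W" using c by auto
  finally have W: "chart_inv c ` cball (chart_map c p) r \<subseteq> W" .
  obtain m M where "m > 0" "M > 0"
    "\<And>p' v. p' \<in> chart_dom c \<Longrightarrow> chart_map c p' \<in> cball (chart_map c p) r \<Longrightarrow>
       v \<in> tangent_space A p' \<Longrightarrow> m * norm (v c) \<le> tnorm g p' v \<and> tnorm g p' v \<le> M * norm (v c)"
    using tnorm_local_bounds[OF c(1) compact_cball sub] by metis
  then show ?thesis using that[OF c r(1) _ _ sub W] by blast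
qed

text \<open>Near \<open>p\<close>, coordinate segments serve as short curves from \<open>p\<close>.\<close>

lemma eventually_reach_short:
  assumes "e > 0"
  shows "\<forall>\<^sub>F q in nhds p. \<exists>l<e. reach p q l"
proof -
  obtain c r m M where c: "c \<in> A" "p \<in> chart_dom c" and r: "r > 0" and M: "M > 0"
    and ball: "cball (chart_map c p) r \<subseteq> chart_img c"
    and bound: "\<And>p' v. p' \<in> chart_dom c \<Longrightarrow> chart_map c p' \<in> cball (chart_map c p) r \<Longrightarrow>
       v \<in> tangent_space A p' \<Longrightarrow> m * norm (v c) \<le> tnorm g p' v \<and> tnorm g p' v \<le> M * norm (v c)"
    using good_chart_ball[OF open_UNIV UNIV_I, of p] by metis
  define \<rho> where "\<rho> = min r (e / M)"
  have \<rho>: "\<rho> > 0" "\<rho> \<le> r" "\<rho> \<le> e / M" using r M assms by (auto simp: \<rho>_def)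
  have "\<forall>\<^sub>F q in nhds p. q \<in> {q \<in> chart_dom c. chart_map c q \<in> ball (chart_map c p) \<rho>}"
    using c \<rho>(1) by (intro eventually_nhds_in_open open_chart_vimage) auto
  then show ?thesis
  proof eventually_elim
    case (elim q)
    then have q: "chart_map c q \<in> ball (chart_map c p) \<rho>" "q \<in> chart_dom c" by simp_all
    have n: "norm (chart_map c q - chart_map c p) < \<rho>"
      using q(1) by (simp add: dist_norm norm_minus_commute)
    have seg: "closed_segment (chart_map c p) (chart_map c q) \<subseteq> cball (chart_map c p) r"
      using q(1) \<rho> r by (intro closed_segment_subset) auto
    have "\<exists>l. reach p q l \<and> l \<le> M * norm (chart_map c q - chart_map c p)"
    proof (rule reach_segment[OF c(1,2) q(2)])
      show "closed_segment (chart_map c p) (chart_map c q) \<subseteq> chart_img c" using seg ball by blast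
      show "tnorm g p' v \<le> M * norm (v c)"
        if "p' \<in> chart_dom c" "chart_map c p' \<in> closed_segment (chart_map c p) (chart_map c q)"
          "v \<in> tangent_space A p'" for p' v
        using bound[OF that(1) _ that(3)] that(2) seg by blast
    qed
    moreover have "M * norm (chart_map c q - chart_map c p) < M * \<rho>" using n M by simp
    moreover have "M * \<rho> \<le> e" using \<rho>(3) M by (simp add: field_simps)
    ultimately show ?case by force
  qed
qed

text \<open>
  Being joined by a curve is an equivalence relation with open classes, so connectedness leaves only one
  class. The Riemannian distance is therefore an infimum of a nonempty set.
\<close>

lemma reach_exists: "\<exists>l. reach x y l"
proof -
  define S where "S = {y. \<exists>l. reach x y l}"
  have near: "\<exists>U. open U \<and> q \<in> U \<and> (\<forall>z\<in>U. \<exists>l. reach q z l)" for q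
  proof -
    have "\<forall>\<^sub>F z in nhds q. \<exists>l. reach q z l"
      by (rule eventually_mono[OF eventually_reach_short[OF zero_less_one]]) blast
    then show ?thesis unfolding eventually_nhds by blast
  qed
  have closed_under: "z \<in> S \<longleftrightarrow> q \<in> S" if "reach q z l" for q z l
    unfolding S_def using reach_trans that reach_sym[OF that] by blast
  have "\<exists>U. open U \<and> q \<in> U \<and> U \<subseteq> S" if "q \<in> S" for q
  proof -
    obtain U where U: "open U" "q \<in> U" "\<forall>z\<in>U. \<exists>l. reach q z l" using near by blast
    have "U \<subseteq> S" using U(3) closed_under that by fast
    then show ?thesis using U by blast
  qed
  then have "open S" by (subst open_subopen) blast
  have "\<exists>U. open U \<and> q \<in> U \<and> U \<subseteq> - S" if "q \<in> - S" for q
  proof -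
    obtain U where U: "open U" "q \<in> U" "\<forall>z\<in>U. \<exists>l. reach q z l" using near by blast
    have "U \<subseteq> - S" using U(3) closed_under that by fast
    then show ?thesis using U by blast
  qed
  then have "open (- S)" by (subst open_subopen) blast
  have "x \<in> S" using reach_refl by (auto simp: S_def)
  have "- S = {}"
    using connectedD[OF connected_manifold \<open>open S\<close> \<open>open (- S)\<close>] \<open>x \<in> S\<close> by blast
  then show ?thesis by (auto simp: S_def)
qed

lemma rdist_le_reach: "reach x y l \<Longrightarrow> rdist A g x y \<le> l"
  unfolding rdist_eq_Inf_reach
  by (rule cInf_lower) (auto intro!: bdd_belowI[of _ 0] reach_nonneg)

lemma rdist_less_iff: "rdist A g x y < e \<longleftrightarrow> (\<exists>l<e. reach x y l)"
proof
  assume "rdist A g x y < e"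
  moreover have "{l. reach x y l} \<noteq> {}" using reach_exists by simp
  ultimately show "\<exists>l<e. reach x y l"
    unfolding rdist_eq_Inf_reach using cInf_lessD by (metis mem_Collect_eq)
qed (use rdist_le_reach in force)

lemma rdist_nonneg: "rdist A g x y \<ge> 0"
  using rdist_less_iff[of x y 0] reach_nonneg by force

text \<open>
  A curve from \<open>p\<close> to a point outside \<open>W\<close> has to leave a coordinate ball in \<open>W\<close>, which takes a length
  of at least \<open>m * r\<close>.
\<close>

lemma rdist_small_in_open:
  assumes "open W" "p \<in> W"
  obtains e where "e > 0" "\<And>q. rdist A g p q < e \<Longrightarrow> q \<in> W"
proof -
  obtain c r m M where c: "c \<in> A" "p \<in> chart_dom c" and r: "r > 0" and m: "m > 0"
    and ball: "cball (chart_map c p) r \<subseteq> chart_img c" and W: "chart_inv c ` cball (chart_map c p) r \<subseteq> W"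
    and bound: "\<And>p' v. p' \<in> chart_dom c \<Longrightarrow> chart_map c p' \<in> cball (chart_map c p) r \<Longrightarrow>
       v \<in> tangent_space A p' \<Longrightarrow> m * norm (v c) \<le> tnorm g p' v \<and> tnorm g p' v \<le> M * norm (v c)"
    using good_chart_ball[OF assms] by metis
  show ?thesis
  proof (rule that[of "m * r"])
    fix q assume "rdist A g p q < m * r"
    then obtain l where l: "l < m * r" "reach p q l" using rdist_less_iff by blast
    have q: "q \<in> chart_dom c \<and> m * norm (chart_map c q - chart_map c p) \<le> l"
      by (rule reach_short_stays[OF c m r ball _ l(2,1)]) (use bound in blast)
    then have "m * norm (chart_map c q - chart_map c p) < m * r" using l by simp
    then have "chart_map c q \<in> cball (chart_map c p) r"
      using m by (simp add: dist_norm norm_minus_commute)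
    then have "chart_inv c (chart_map c q) \<in> W" using W by blast
    then show "q \<in> W" using q c by simp
  qed (use m r in simp)
qed

lemma Metric_space_rdist: "Metric_space UNIV (rdist A g)"
proof
  fix x y z
  show "0 \<le> rdist A g x y" by (rule rdist_nonneg)
  show "rdist A g x y = rdist A g y x"
    unfolding rdist_eq_Inf_reach using reach_sym by (intro arg_cong[where f = Inf]) blast
  show "rdist A g x y = 0 \<longleftrightarrow> x = y"
  proof
    assume "rdist A g x y = 0"
    show "x = y"
    proof (rule ccontr)
      assume "x \<noteq> y"
      then have "open (- {y})" "x \<in> - {y}" by auto
      then obtain e where e: "e > 0" "\<And>q. rdist A g x q < e \<Longrightarrow> q \<in> - {y}"
        using rdist_small_in_open by blast
      have "y \<in> - {y}" by (rule e(2)) (use e(1) \<open>rdist A g x y = 0\<close> in simp)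
      then show False by simp
    qed
  next
    assume "x = y"
    then show "rdist A g x y = 0" using rdist_le_reach[OF reach_refl, of x] rdist_nonneg[of x y] by simp
  qed
  show "rdist A g x z \<le> rdist A g x y + rdist A g y z"
  proof (rule field_le_epsilon)
    fix e :: real assume "e > 0"
    obtain l where l: "l < rdist A g x y + e / 2" "reach x y l"
      using rdist_less_iff[of x y "rdist A g x y + e / 2"] \<open>e > 0\<close> by auto
    obtain l' where l': "l' < rdist A g y z + e / 2" "reach y z l'"
      using rdist_less_iff[of y z "rdist A g y z + e / 2"] \<open>e > 0\<close> by auto
    show "rdist A g x z \<le> rdist A g x y + rdist A g y z + e"
      using rdist_le_reach[OF reach_trans[OF l(2) l'(2)]] l(1) l'(1) by simp
  qed
qed

sublocale riem: Metric_space UNIV "rdist A g"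
  by (rule Metric_space_rdist)

lemma rdist_mtopology: "riem.mtopology = euclidean"
  unfolding topology_eq
proof (intro allI iffI)
  fix U
  assume U: "openin riem.mtopology U"
  have "\<exists>T. open T \<and> p \<in> T \<and> T \<subseteq> U" if p: "p \<in> U" for p
  proof -
    obtain e where e: "e > 0" "riem.mball p e \<subseteq> U"
      using U p unfolding riem.openin_mtopology by blast
    obtain T where T: "open T" "p \<in> T" "\<And>q. q \<in> T \<Longrightarrow> \<exists>l<e. reach p q l"
      using eventually_reach_short[OF e(1), of p] unfolding eventually_nhds by blast
    have "T \<subseteq> U"
    proof
      fix q assume "q \<in> T"
      then have "rdist A g p q < e" using T(3) rdist_less_iff by blast
      then show "q \<in> U" using e(2) by (auto simp: subset_iff)
    qed
    then show ?thesis using T by blast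
  qed
  then show "openin euclidean U" using open_subopen[of U] by simp
next
  fix U :: "'a set"
  assume "openin euclidean U"
  then have "open U" by simp
  have "\<exists>r>0. riem.mball p r \<subseteq> U" if "p \<in> U" for p
    using rdist_small_in_open[OF \<open>open U\<close> that] by (metis riem.in_mball subsetI)
  then show "openin riem.mtopology U" by (simp add: riem.openin_mtopology)
qed

text \<open>Small balls lie in compact coordinate balls, which makes the manifold locally compact.\<close>

lemma rdist_locally_compact: "\<exists>r>0. compactin riem.mtopology (riem.mcball p r)"
proof -
  obtain c r m M where c: "c \<in> A" "p \<in> chart_dom c" and r: "r > 0"
    and ball: "cball (chart_map c p) r \<subseteq> chart_img c"
    using good_chart_ball[OF open_UNIV UNIV_I, of p] by metis
  define K where "K = chart_inv c ` cball (chart_map c p) r"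
  define W where "W = {q \<in> chart_dom c. chart_map c q \<in> ball (chart_map c p) r}"
  have "compact K"
    unfolding K_def
    by (rule compact_continuous_image[OF continuous_on_subset[OF continuous_on_chart_inv[OF c(1)] ball] compact_cball])
  have "open W" unfolding W_def by (rule open_chart_vimage[OF c(1) open_ball])
  moreover have "p \<in> W" using c r by (simp add: W_def)
  ultimately obtain e where e: "e > 0" "\<And>q. rdist A g p q < e \<Longrightarrow> q \<in> W"
    using rdist_small_in_open by blast
  have "W \<subseteq> K"
  proof
    fix q assume "q \<in> W"
    then have "q = chart_inv c (chart_map c q)" "chart_map c q \<in> cball (chart_map c p) r"
      using c by (auto simp: W_def)
    then show "q \<in> K" unfolding K_def by (rule image_eqI)
  qed
  then have "riem.mcball p (e/2) \<subseteq> K" using e by force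
  then have "compactin riem.mtopology (riem.mcball p (e/2))"
    using closed_compactin[of riem.mtopology K] \<open>compact K\<close> riem.closedin_mcball
    by (simp add: rdist_mtopology)
  then show ?thesis using e(1) by (intro exI[of _ "e/2"]) simp
qed

lemma rdist_split:
  assumes "s > 0" "t > 0" "rdist A g x y < s + t"
  shows "\<exists>z. rdist A g x z < s \<and> rdist A g z y < t"
proof -
  obtain l where l: "l < s + t" "reach x y l" using assms(3) rdist_less_iff by blast
  have "l \<ge> 0" using reach_nonneg[OF l(2)] .
  define u where "u = (max 0 (l - t) + min s l) / 2"
  have u: "0 \<le> u" "u \<le> l" "u < s" "l - u < t"
    using \<open>l \<ge> 0\<close> l(1) assms(1,2) by (auto simp: u_def max_def min_def field_simps)
  obtain z where "reach x z u" "reach z y (l - u)" using reach_split[OF l(2) u(1,2)] by blast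
  then have "rdist A g x z < s" "rdist A g z y < t" using u rdist_less_iff by blast+
  then show ?thesis by blast
qed

lemma complete_imp_mcball_compactin:
  assumes "riem.mcomplete"
  shows "compactin riem.mtopology (riem.mcball p r)"
  using rdist_locally_compact rdist_split
  by (intro riem.length_space_mcball_compactin[OF assms]) auto

end


section \<open>Convergence of descent sequences\<close>

theorem theorem7p1:
  fixes A :: "('a::{t2_space, second_countable_topology}, 'n::finite) chart set"
    and g :: "('a, 'n) metric_tensor"
    and f :: "'a \<Rightarrow> real"
    and D :: "'a \<Rightarrow> 'a \<Rightarrow> real"
    and L s1 s2 r1 r2 :: real
    and x :: "nat \<Rightarrow> 'a"
  assumes "riemannian_manifold A g"
    and "Metric_space.mcomplete UNIV (rdist A g)"
    and "C1_fun A f" and "L > 0" and "lipschitz_gradient A g L f"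
    and "bdd_below (range f)"
    and "quasi_distance D"
    and "s1 > 0" and "s2 > 0"
    and "\<And>p q. s1 * rdist A g p q \<le> D p q \<and> D p q \<le> s2 * rdist A g p q"
    and "r1 > 0" and "r2 > 0"
    and "KL_function A g (\<lambda>p. ereal (f p))"
    and "Metric_space.mbounded UNIV (rdist A g) (range x)"
    and "\<And>k. f (x (Suc k)) + r1 * (D (x (Suc k)) (x k))\<^sup>2 \<le> f (x k)"
    and "\<And>k. tnorm g (x k) (grad A g f (x k)) \<le> r2 * D (x (Suc k)) (x k)"
  shows "\<exists>xb. x \<longlonglongrightarrow> xb \<and> critical_point A g (\<lambda>p. ereal (f p)) xb"
proof -
  interpret riemannian A g by (rule riemannian.intro) fact
  note C1 = \<open>C1_fun A f\<close> and decrease = assms(15) and slope = assms(16)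
  have lim_iff: "limitin riem.mtopology \<sigma> b sequentially \<longleftrightarrow> \<sigma> \<longlonglongrightarrow> b" for \<sigma> :: "nat \<Rightarrow> 'a" and b
    by (simp add: rdist_mtopology)
  \<comment> \<open>Bounded sets are relatively compact, so the sequence has a cluster point.\<close>
  obtain p B where "range x \<subseteq> riem.mcball p B"
    using assms(14) unfolding riem.mbounded_def by blast
  then obtain b \<rho> where sub: "strict_mono \<rho>" "limitin riem.mtopology (x \<circ> \<rho>) b sequentially"
    using complete_imp_mcball_compactin[OF assms(2)] unfolding riem.compactin_sequentially by metis
  have cluster: "\<exists>k\<ge>N. rdist A g (x k) b < e" if "e > 0" for e N
  proof -
    obtain n where n: "\<And>j. j \<ge> n \<Longrightarrow> rdist A g (x (\<rho> j)) b < e"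
      using sub(2) \<open>e > 0\<close> unfolding riem.limit_metric_sequentially by auto
    have "\<rho> (max n N) \<ge> N" using seq_suble[OF sub(1), of "max n N"] by simp
    then show ?thesis using n[of "max n N"] by (intro exI[of _ "\<rho> (max n N)"]) simp
  qed
  \<comment> \<open>The values decrease to their infimum, which continuity identifies as the value at \<open>b\<close>.\<close>
  have D0: "0 \<le> D p q" for p q using \<open>quasi_distance D\<close> by (simp add: quasi_distance_def)
  have "0 \<le> r1 * (D (x (Suc k)) (x k))\<^sup>2" for k using \<open>r1 > 0\<close> by simp
  then have "f (x (Suc k)) \<le> f (x k)" for k using decrease[of k] by (smt (verit))
  then have "decseq (\<lambda>k. f (x k))" by (rule decseq_SucI)
  moreover have "bdd_below (range (\<lambda>k. f (x k)))"
    using \<open>bdd_below (range f)\<close> by (rule bdd_below_mono) auto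
  ultimately have conv: "(\<lambda>k. f (x k)) \<longlonglongrightarrow> (INF k. f (x k))"
    by (intro LIMSEQ_decseq_INF)
  have "(\<lambda>j. f (x (\<rho> j))) \<longlonglongrightarrow> f b"
    using isCont_tendsto_compose[OF C1_continuous[OF C1]] sub(2) unfolding lim_iff comp_def by blast
  moreover have "(\<lambda>j. f (x (\<rho> j))) \<longlonglongrightarrow> (INF k. f (x k))"
    using LIMSEQ_subseq_LIMSEQ[OF conv sub(1)] by (simp add: comp_def)
  ultimately have F: "(\<lambda>k. f (x k)) \<longlonglongrightarrow> f b" using conv LIMSEQ_unique by metis
  have "limiting_subdiff A g (\<lambda>p. ereal (f p)) b \<noteq> {}" using grad_in_limiting_subdiff[OF C1] by blast
  then have "KL_property A g (\<lambda>p. ereal (f p)) b" using assms(13) by (simp add: KL_function_def)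
  then obtain \<eta> :: ereal and U \<phi> where \<eta>: "0 < \<eta>" and bU: "b \<in> interior U"
    and cont: "continuous_on {s. 0 \<le> s \<and> ereal s < \<eta>} \<phi>"
    and conc: "concave_on {s. 0 \<le> s \<and> ereal s < \<eta>} \<phi>"
    and nonneg: "\<And>s. 0 \<le> s \<Longrightarrow> ereal s < \<eta> \<Longrightarrow> 0 \<le> \<phi> s"
    and zero: "\<phi> 0 = 0"
    and deriv: "\<And>s. 0 < s \<Longrightarrow> ereal s < \<eta> \<Longrightarrow> \<phi> differentiable (at s) \<and> 0 < deriv \<phi> s"
    and KL: "\<And>q. q \<in> U \<Longrightarrow> ereal (f b) < ereal (f q) \<Longrightarrow> ereal (f q) < ereal (f b) + \<eta> \<Longrightarrow>
        ereal (deriv \<phi> (real_of_ereal (ereal (f q) - ereal (f b)))) * dist0_subdiff A g (\<lambda>p. ereal (f p)) q \<ge> 1"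
    unfolding KL_property_def by blast
  obtain \<delta> where \<delta>: "\<delta> > 0" "\<And>q. rdist A g b q < \<delta> \<Longrightarrow> q \<in> interior U"
    using rdist_small_in_open[OF open_interior bU] by blast
  have KL': "deriv \<phi> (f q - f b) * tnorm g q (grad A g f q) \<ge> 1"
    if q: "rdist A g q b < \<delta>" "f b < f q" "ereal (f q - f b) < \<eta>" for q
  proof -
    have "q \<in> U" using \<delta>(2)[of q] q(1) riem.commute interior_subset by fastforce
    moreover have "ereal (f q) < ereal (f b) + \<eta>" using q(3) by (cases \<eta>) auto
    ultimately have "1 \<le> ereal (deriv \<phi> (f q - f b)) * dist0_subdiff A g (\<lambda>p. ereal (f p)) q"
      using KL[of q] q(2) by simp
    also have "\<dots> \<le> ereal (deriv \<phi> (f q - f b)) * ereal (tnorm g q (grad A g f q))"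
      using deriv[of "f q - f b"] q(2,3)
      by (intro ereal_mult_left_mono dist0_subdiff_le_tnorm_grad[OF C1]) auto
    finally show ?thesis by (simp add: one_ereal_def)
  qed
  have "limitin riem.mtopology x b sequentially"
  proof (rule riem.KL_descent_converges[OF _ _ cluster F decrease slope _ \<open>r1 > 0\<close> \<open>r2 > 0\<close> \<open>s1 > 0\<close> \<eta> \<delta>(1)
        cont conc nonneg zero deriv])
    show "s1 * rdist A g (x (Suc k)) (x k) \<le> D (x (Suc k)) (x k)" for k using assms(10) by blast
    show "1 \<le> deriv \<phi> (f (x k) - f b) * tnorm g (x k) (grad A g f (x k))"
      if "rdist A g (x k) b < \<delta>" "f b < f (x k)" "ereal (f (x k) - f b) < \<eta>" for k
      using KL'[OF that] .
  qed auto
  then have x: "x \<longlonglongrightarrow> b" by (simp add: lim_iff)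
  \<comment> \<open>The squared steps are dominated by differences of the convergent values, so steps and slopes vanish.\<close>
  have "(\<lambda>k. (f (x k) - f (x (Suc k))) / r1) \<longlonglongrightarrow> (f b - f b) / r1"
    using F LIMSEQ_Suc[OF F] \<open>r1 > 0\<close> by (intro tendsto_intros) auto
  then have diff0: "(\<lambda>k. (f (x k) - f (x (Suc k))) / r1) \<longlonglongrightarrow> 0" by simp
  have "(\<lambda>k. (D (x (Suc k)) (x k))\<^sup>2) \<longlonglongrightarrow> 0"
  proof (rule tendsto_sandwich[OF _ _ tendsto_const diff0])
    show "\<forall>\<^sub>F k in sequentially. (D (x (Suc k)) (x k))\<^sup>2 \<le> (f (x k) - f (x (Suc k))) / r1"
      using decrease \<open>r1 > 0\<close> by (intro always_eventually allI) (simp add: field_simps)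
  qed simp
  then have "(\<lambda>k. sqrt ((D (x (Suc k)) (x k))\<^sup>2)) \<longlonglongrightarrow> sqrt 0" by (rule tendsto_real_sqrt)
  then have step0: "(\<lambda>k. r2 * D (x (Suc k)) (x k)) \<longlonglongrightarrow> 0"
    using D0 by (auto intro: tendsto_mult_right_zero)
  have "(\<lambda>k. tnorm g (x k) (grad A g f (x k))) \<longlonglongrightarrow> 0"
    by (rule tendsto_sandwich[OF _ _ tendsto_const step0])
       (use slope tnorm_nonneg[OF grad_in_tangent_space[OF C1]] in auto)
  then show ?thesis using x critical_point_of_grad_tendsto_0[OF C1 x] by blast
qed

end
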